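(* Let $\mathbb{K}$ be an algebraically closed field, $V$ a $\mathbb{K}$-vector space of finite positive dimension, and $\Phi=(A;\{E_i\}_{i=0}^d;A^*;\{E_i^*\}_{i=0}^d)$ a TD system on $V$ of diameter $d\geq 1$ that has $q$-Racah type, with fixed associated scalars $q,a,b$. Let $\psi$ and $\Delta$ be the associated elements of $\mathrm{End}(V)$ defined in the context. Then both $$\Delta=\exp_{q}\left(\frac{a}{q-q^{-1}}\psi\right)\exp_{q^{-1}}\left(-\frac{a^{-1}}{q-q^{-1}}\psi\right),$$ $$\Delta^{-1}=\exp_{q}\left(\frac{a^{-1}}{q-q^{-1}}\psi\right)\exp_{q^{-1}}\left(-\frac{a}{q-q^{-1}}\psi\right).$$
   Context: TD pair: an ordered pair of linear maps $A,A^*:V\to V$ such that (i) each is diagonalizable; (ii) there is an ordering $\{V_i\}_{i=0}^d$ of the eigenspaces of $A$ with $A^*V_i\subseteq V_{i-1}+V_i+V_{i+1}$ for $0\le i\le d$ ($V_{-1}=V_{d+1}=0$); (iii) there is an ordering $\{V_i^*\}_{i=0}^\delta$ of the eigenspaces of $A^*$ with $AV_i^*\subseteq V_{i-1}^*+V_i^*+V_{i+1}^*$ for $0\le i\le\delta$ ($V^*_{-1}=V^*_{\delta+1}=0$); (iv) no subspace $W$ with $0\ne W\ne V$ satisfies $AW\subseteq W$ and $A^*W\subseteq W$. It is known that $d=\delta$; $d$ is called the diameter. Orderings as in (ii), (iii) are called standard. The primitive idempotent of $A$ for an eigenspace $V_i$ is the projection of $V$ onto $V_i$ that vanishes on the other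 eigenspaces (similarly for $A^*$). TD system: $(A;\{E_i\}_{i=0}^d;A^*;\{E_i^*\}_{i=0}^d)$ where $A,A^*$ is a TD pair and $\{E_i\}$, $\{E_i^*\}$ are the primitive idempotents of $A$, $A^*$, in orders for which the corresponding eigenspace orderings $\{E_iV\}$, $\{E_i^*V\}$ are standard. Let $\theta_i$ (resp. $\theta_i^*$) be the eigenvalue of $A$ on $E_iV$ (resp. of $A^*$ on $E_i^*V$). $\Phi$ has $q$-Racah type if there are nonzero $q,a,b\in\mathbb{K}$ with $q^4\ne1$ and $\theta_i=aq^{d-2i}+a^{-1}q^{2i-d}$, $\theta_i^*=bq^{d-2i}+b^{-1}q^{2i-d}$ for $0\le i\le d$. (Distinctness of eigenvalues forces $q^{2i}\neq1$ for $1\le i\le d$, and $a^2\ne q^{2d-2},q^{2d-4},\dots,q^{2-2d}$; in particular $a^2\neq 1$.) Split decompositions: $U_i=(E_0^*V+\cdots+E_i^*V)\cap(E_iV+\cdots+E_dV)$ and $U_i^\Downarrow=(E_0^*V+\cdots+E_i^*V)\cap(E_0V+\cdots+E_{d-i}V)$ for $0\le i\le d$. It is known that $V=\bigoplus_i U_i=\bigoplus_i U_i^\Downarrow$ with all summands nonzero. $K,B\in\mathrm{End}(V)$ are the linear maps acting on $U_i$, respectively $U_i^\Downarrow$, as the scalar $q^{d-2i}$ ($0\le i\le d$). $\psi\in\mathrm{End}(V)$: $\psi=(I-BK^{-1})\,\bigl(q(aI-a^{-1}BK^{-1})\bigr)^{-1}$ (the inverse is known to exist; it is known that $\psi$ also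 equals $q(I-K^{-1}B)(aI-a^{-1}K^{-1}B)^{-1}$, $(I-KB^{-1})(q(a^{-1}I-aKB^{-1}))^{-1}$ and $q(I-B^{-1}K)(a^{-1}I-aB^{-1}K)^{-1}$). It is known that $\psi^{d+1}=0$. $\Delta\in\mathrm{End}(V)$: the unique (known to exist, and known to be invertible) linear map with $\Delta U_i\subseteq U_i^\Downarrow$ and $(\Delta-I)U_i\subseteq U_0+\cdots+U_{i-1}$ for $0\le i\le d$. $q$-exponential: $[n]_q=\frac{q^n-q^{-n}}{q-q^{-1}}$, $[n]_q^!=[n]_q[n-1]_q\cdots[1]_q$, $[0]_q^!=1$; for nilpotent $T$, $\exp_q(T)=\sum_{n\ge0}\frac{q^{\binom n2}}{[n]_q^!}T^n$ and $\exp_{q^{-1}}(T)=\sum_{n\ge0}\frac{q^{-\binom n2}}{[n]_q^!}T^n$. For $T$ a scalar multiple of $\psi$ the sums run over $0\le n\le d$, since $\psi^{d+1}=0$. *)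

theory Defs
  imports "HOL-Computational_Algebra.Polynomial" "HOL-Library.Set_Algebras"
begin

text \<open>
  The vector space \<open>V\<close> is the whole type \<open>'b\<close>; elements of \<open>End(V)\<close> are functions
  \<open>'b \<Rightarrow> 'b\<close> satisfying \<open>Vector_Spaces.linear scale scale\<close>, so the image \<open>E V\<close> is
  \<open>range E\<close>.  Sums of subspaces are the elementwise sums of
  \<^theory>\<open>HOL-Library.Set_Algebras\<close>; the empty sum is the zero subspace \<open>{0}\<close>.
\<close>

definition eigenspace ::
  "('a::field \<Rightarrow> 'b::ab_group_add \<Rightarrow> 'b) \<Rightarrow>
   ('b \<Rightarrow> 'b) \<Rightarrow> 'a \<Rightarrow> 'b set" where
  "eigenspace scale A \<theta> = {v. A v = scale \<theta> v}"

definition eigenspaces ::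
  "('a::field \<Rightarrow> 'b::ab_group_add \<Rightarrow> 'b) \<Rightarrow>
   ('b \<Rightarrow> 'b) \<Rightarrow> 'b set set" where
  "eigenspaces scale A = {eigenspace scale A \<theta> |\<theta>. eigenspace scale A \<theta> \<noteq> {0}}"

definition diagonalizable ::
  "('a::field \<Rightarrow> 'b::ab_group_add \<Rightarrow> 'b) \<Rightarrow>
   ('b \<Rightarrow> 'b) \<Rightarrow> bool" where
  "diagonalizable scale A \<longleftrightarrow>
     (\<exists>X. \<not> module.dependent scale X \<and> module.span scale X = UNIV \<and>
       (\<forall>v\<in>X. \<exists>\<theta>. A v = scale \<theta> v))"

text \<open>
  The index set \<open>{i - 1..min (i + 1) d}\<close> (truncated subtraction) implements the convention
  that the terms with index \<open>-1\<close> and \<open>d + 1\<close> are zero.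
\<close>

definition standard_ordering ::
  "('a::field \<Rightarrow> 'b::ab_group_add \<Rightarrow> 'b) \<Rightarrow>
   ('b \<Rightarrow> 'b) \<Rightarrow> ('b \<Rightarrow> 'b) \<Rightarrow> nat \<Rightarrow> (nat \<Rightarrow> 'b set) \<Rightarrow> bool" where
  "standard_ordering scale A B d W \<longleftrightarrow>
     bij_betw W {0..d} (eigenspaces scale A) \<and>
     (\<forall>i\<le>d. B ` W i \<subseteq> (\<Sum>j\<in>{i - 1..min (i + 1) d}. W j))"

definition TD_pair ::
  "('a::field \<Rightarrow> 'b::ab_group_add \<Rightarrow> 'b) \<Rightarrow>
   ('b \<Rightarrow> 'b) \<Rightarrow> ('b \<Rightarrow> 'b) \<Rightarrow> bool" where
  "TD_pair scale A As \<longleftrightarrow>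
     Vector_Spaces.linear scale scale A \<and> Vector_Spaces.linear scale scale As \<and>
     diagonalizable scale A \<and> diagonalizable scale As \<and>
     (\<exists>d W. standard_ordering scale A As d W) \<and>
     (\<exists>\<delta> Ws. standard_ordering scale As A \<delta> Ws) \<and>
     \<not> (\<exists>W. module.subspace scale W \<and> W \<noteq> {0} \<and> W \<noteq> UNIV \<and> A ` W \<subseteq> W \<and> As ` W \<subseteq> W)"

definition primitive_idempotent ::
  "('a::field \<Rightarrow> 'b::ab_group_add \<Rightarrow> 'b) \<Rightarrow>
   ('b \<Rightarrow> 'b) \<Rightarrow> 'b set \<Rightarrow> ('b \<Rightarrow> 'b) \<Rightarrow> bool" where
  "primitive_idempotent scale A W E \<longleftrightarrow>
     W \<in> eigenspaces scale A \<and> Vector_Spaces.linear scale scale E \<and>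
     (\<forall>v\<in>W. E v = v) \<and> (\<forall>W'\<in>eigenspaces scale A - {W}. \<forall>v\<in>W'. E v = 0)"

definition TD_system ::
  "('a::field \<Rightarrow> 'b::ab_group_add \<Rightarrow> 'b) \<Rightarrow>
   nat \<Rightarrow> ('b \<Rightarrow> 'b) \<Rightarrow> (nat \<Rightarrow> 'b \<Rightarrow> 'b) \<Rightarrow> ('b \<Rightarrow> 'b) \<Rightarrow> (nat \<Rightarrow> 'b \<Rightarrow> 'b) \<Rightarrow> bool" where
  "TD_system scale d A E As Es \<longleftrightarrow>
     TD_pair scale A As \<and>
     (\<forall>i\<le>d. primitive_idempotent scale A (range (E i)) (E i)) \<and>
     (\<forall>i\<le>d. primitive_idempotent scale As (range (Es i)) (Es i)) \<and>
     standard_ordering scale A As d (\<lambda>i. range (E i)) \<and>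
     standard_ordering scale As A d (\<lambda>i. range (Es i))"

definition eigenvalue_on ::
  "('a::field \<Rightarrow> 'b::ab_group_add \<Rightarrow> 'b) \<Rightarrow>
   ('b \<Rightarrow> 'b) \<Rightarrow> 'b set \<Rightarrow> 'a" where
  "eigenvalue_on scale A W = (THE \<theta>. \<forall>v\<in>W. A v = scale \<theta> v)"

definition q_Racah_with ::
  "('a::field \<Rightarrow> 'b::ab_group_add \<Rightarrow> 'b) \<Rightarrow>
   'a \<Rightarrow> 'a \<Rightarrow> 'a \<Rightarrow> nat \<Rightarrow> ('b \<Rightarrow> 'b) \<Rightarrow> (nat \<Rightarrow> 'b \<Rightarrow> 'b) \<Rightarrow> ('b \<Rightarrow> 'b) \<Rightarrow> (nat \<Rightarrow> 'b \<Rightarrow> 'b) \<Rightarrow> bool"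
  where
  "q_Racah_with scale q a b d A E As Es \<longleftrightarrow>
     q \<noteq> 0 \<and> a \<noteq> 0 \<and> b \<noteq> 0 \<and> q ^ 4 \<noteq> 1 \<and>
     (\<forall>i\<le>d. eigenvalue_on scale A (range (E i)) =
        a * q powi (int d - 2 * int i) + inverse a * q powi (2 * int i - int d)) \<and>
     (\<forall>i\<le>d. eigenvalue_on scale As (range (Es i)) =
        b * q powi (int d - 2 * int i) + inverse b * q powi (2 * int i - int d))"

definition split_U ::
  "nat \<Rightarrow> (nat \<Rightarrow> 'b \<Rightarrow> 'b::ab_group_add) \<Rightarrow> (nat \<Rightarrow> 'b \<Rightarrow> 'b) \<Rightarrow> nat \<Rightarrow> 'b set" where
  "split_U d E Es i = (\<Sum>j\<in>{0..i}. range (Es j)) \<inter> (\<Sum>j\<in>{i..d}. range (E j))"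

definition split_Udown ::
  "nat \<Rightarrow> (nat \<Rightarrow> 'b \<Rightarrow> 'b::ab_group_add) \<Rightarrow> (nat \<Rightarrow> 'b \<Rightarrow> 'b) \<Rightarrow> nat \<Rightarrow> 'b set" where
  "split_Udown d E Es i = (\<Sum>j\<in>{0..i}. range (Es j)) \<inter> (\<Sum>j\<in>{0..d - i}. range (E j))"

text \<open>
  The definite descriptions below are meaningful for TD systems of \<open>q\<close>-Racah type: since
  \<open>V\<close> is the direct sum of the \<open>split_U d E Es i\<close>, and also of
  the \<open>split_Udown d E Es i\<close>, the map described exists
  and is unique.
\<close>

definition K_map ::
  "('a::field \<Rightarrow> 'b::ab_group_add \<Rightarrow> 'b) \<Rightarrow>
   'a \<Rightarrow> nat \<Rightarrow> (nat \<Rightarrow> 'b \<Rightarrow> 'b) \<Rightarrow> (nat \<Rightarrow> 'b \<Rightarrow> 'b) \<Rightarrow> 'b \<Rightarrow> 'b" where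
  "K_map scale q d E Es = (THE K. Vector_Spaces.linear scale scale K \<and>
     (\<forall>i\<le>d. \<forall>u\<in>split_U d E Es i. K u = scale (q powi (int d - 2 * int i)) u))"

definition B_map ::
  "('a::field \<Rightarrow> 'b::ab_group_add \<Rightarrow> 'b) \<Rightarrow>
   'a \<Rightarrow> nat \<Rightarrow> (nat \<Rightarrow> 'b \<Rightarrow> 'b) \<Rightarrow> (nat \<Rightarrow> 'b \<Rightarrow> 'b) \<Rightarrow> 'b \<Rightarrow> 'b" where
  "B_map scale q d E Es = (THE B. Vector_Spaces.linear scale scale B \<and>
     (\<forall>i\<le>d. \<forall>u\<in>split_Udown d E Es i. B u = scale (q powi (int d - 2 * int i)) u))"

definition psi ::
  "('a::field \<Rightarrow> 'b::ab_group_add \<Rightarrow> 'b) \<Rightarrow>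
   'a \<Rightarrow> 'a \<Rightarrow> nat \<Rightarrow> (nat \<Rightarrow> 'b \<Rightarrow> 'b) \<Rightarrow> (nat \<Rightarrow> 'b \<Rightarrow> 'b) \<Rightarrow> 'b \<Rightarrow> 'b" where
  "psi scale q a d E Es =
     (let BKinv = B_map scale q d E Es \<circ> inv (K_map scale q d E Es)
      in (\<lambda>v. v - BKinv v) \<circ> inv (\<lambda>v. scale q (scale a v - scale (inverse a) (BKinv v))))"

definition Delta ::
  "('a::field \<Rightarrow> 'b::ab_group_add \<Rightarrow> 'b) \<Rightarrow>
   nat \<Rightarrow> (nat \<Rightarrow> 'b \<Rightarrow> 'b) \<Rightarrow> (nat \<Rightarrow> 'b \<Rightarrow> 'b) \<Rightarrow> 'b \<Rightarrow> 'b" where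
  "Delta scale d E Es = (THE D. Vector_Spaces.linear scale scale D \<and>
     (\<forall>i\<le>d. D ` split_U d E Es i \<subseteq> split_Udown d E Es i \<and>
            (\<lambda>u. D u - u) ` split_U d E Es i \<subseteq> (\<Sum>j<i. split_U d E Es j)))"

definition q_int :: "'a::field \<Rightarrow> nat \<Rightarrow> 'a" where
  "q_int q n = (q ^ n - inverse q ^ n) / (q - inverse q)"

definition q_fact :: "'a::field \<Rightarrow> nat \<Rightarrow> 'a" where
  "q_fact q n = (\<Prod>k=1..n. q_int q k)"

text \<open>
  The \<open>q\<close>-exponentials are meant for nilpotent \<open>T\<close>: then the index set
  \<open>{n. T ^^ n \<noteq> (\<lambda>_. 0)}\<close> is finite and contains all \<open>n\<close> with a nonzero term,
  so the sum equals the formal infinite series.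
\<close>

definition exp_q ::
  "('a::field \<Rightarrow> 'b::ab_group_add \<Rightarrow> 'b) \<Rightarrow>
   'a \<Rightarrow> ('b \<Rightarrow> 'b) \<Rightarrow> 'b \<Rightarrow> 'b" where
  "exp_q scale q T v =
     (\<Sum>n | T ^^ n \<noteq> (\<lambda>_. 0). scale (q ^ (n choose 2) / q_fact q n) ((T ^^ n) v))"

definition exp_q_inv ::
  "('a::field \<Rightarrow> 'b::ab_group_add \<Rightarrow> 'b) \<Rightarrow>
   'a \<Rightarrow> ('b \<Rightarrow> 'b) \<Rightarrow> 'b \<Rightarrow> 'b" where
  "exp_q_inv scale q T v =
     (\<Sum>n | T ^^ n \<noteq> (\<lambda>_. 0). scale (inverse q ^ (n choose 2) / q_fact q n) ((T ^^ n) v))"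

end

theory Submission
  imports Defs
begin

text \<open>
  Put \<open>X = B K\<^sup>-\<^sup>1\<close>.  Everything rests on the relation \<open>K \<psi> = q\<^sup>2 \<psi> K\<close>, which is equivalent to
  a quadratic relation \<open>Q = 0\<close> between \<open>K\<close> and \<open>B\<close>.  As an \<open>A\<close>-module, \<open>V\<close> is generated by
  the intersections of \<open>U\<^sub>i\<close> with its counterpart for the reversed ordering of the eigenspaces
  of \<open>A\<close>; on these \<open>Q\<close> vanishes because \<open>K\<close> and \<open>B\<close> act as the same scalar, and the
  \<open>q\<close>-commutation of \<open>A\<close> with \<open>K\<close> and \<open>B\<close> propagates the vanishing.  Given the relation, the
  functional equation \<open>exp\<^sub>q(x) = (1 - q (q - q\<^sup>-\<^sup>1) x) exp\<^sub>q(q\<^sup>2 x)\<close> shows that the product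
  of exponentials intertwines \<open>K\<close> and \<open>B\<close>, hence maps \<open>U\<^sub>i\<close> into its counterpart; it is
  unipotent with respect to the flag of partial sums, and \<open>\<Delta>\<close> is the only such map.
\<close>

section \<open>Linear endomorphisms\<close>

locale endomorphisms = vector_space scale
  for scale :: "'a::field \<Rightarrow> 'b::ab_group_add \<Rightarrow> 'b" (infixr \<open>*s\<close> 75)
begin

abbreviation lin :: "('b \<Rightarrow> 'b) \<Rightarrow> bool" where
  "lin f \<equiv> Vector_Spaces.linear scale scale f"

lemma linI: "(\<And>x y. f (x + y) = f x + f y) \<Longrightarrow> (\<And>c x. f (scale c x) = scale c (f x)) \<Longrightarrow> lin f"
  by (simp add: Vector_Spaces.linear_iff vector_space_axioms)

lemma lin_hom: "lin f \<Longrightarrow> module_hom scale scale f"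
  by (simp add: linear_iff_module_hom)

lemmas lin_add = module_hom.add[OF lin_hom]
lemmas lin_scale = module_hom.scale[OF lin_hom]
lemmas lin_zero = module_hom.zero[OF lin_hom]
lemmas lin_diff = module_hom.diff[OF lin_hom]
lemmas lin_neg = module_hom.neg[OF lin_hom]
lemmas lin_sum = module_hom.sum[OF lin_hom]
lemmas lin_simps = lin_add lin_scale lin_zero lin_diff lin_neg lin_sum

lemma lin_ident: "lin (\<lambda>v. v)"
  by (rule linI) auto

lemma lin_const_zero: "lin (\<lambda>v. 0)"
  by (rule linI) auto

lemma lin_scale_right: "lin f \<Longrightarrow> lin (\<lambda>v. c *s f v)"
  by (rule linI) (simp_all add: lin_add[of f] lin_scale[of f] scale_right_distrib mult.commute)

lemma lin_plus: "lin f \<Longrightarrow> lin g \<Longrightarrow> lin (\<lambda>v. f v + g v)"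
  by (rule linI) (simp_all add: lin_add[of f] lin_add[of g] lin_scale[of f] lin_scale[of g] scale_right_distrib)

lemma lin_minus: "lin f \<Longrightarrow> lin g \<Longrightarrow> lin (\<lambda>v. f v - g v)"
  by (rule linI)
    (simp_all add: lin_add[of f] lin_add[of g] lin_scale[of f] lin_scale[of g] scale_right_diff_distrib)

lemma lin_compose: "lin f \<Longrightarrow> lin g \<Longrightarrow> lin (\<lambda>v. f (g v))"
  by (rule linI) (simp_all add: lin_add[of f] lin_add[of g] lin_scale[of f] lin_scale[of g])

lemma lin_setsum: "(\<And>i. i \<in> I \<Longrightarrow> lin (f i)) \<Longrightarrow> lin (\<lambda>v. \<Sum>i\<in>I. f i v)"
  by (induct I rule: infinite_finite_induct) (auto intro: lin_const_zero lin_plus)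

lemma lin_funpow: "lin f \<Longrightarrow> lin (f ^^ n)"
proof (induct n)
  case 0
  then show ?case using lin_ident by (simp add: id_def)
next
  case (Suc n)
  then show ?case using lin_compose[of f "f ^^ n"] by (simp add: o_def)
qed

lemmas lin_intros = lin_ident lin_const_zero lin_scale_right lin_plus lin_minus lin_setsum

lemma lin_subspace_vimage: "lin f \<Longrightarrow> subspace S \<Longrightarrow> subspace {v. f v \<in> S}"
  by (rule subspaceI) (auto simp: lin_zero[of f] lin_add[of f] lin_scale[of f] subspace_0 subspace_add subspace_scale)

lemma subspace_diff_memD: "subspace S \<Longrightarrow> x - y \<in> S \<Longrightarrow> y \<in> S \<Longrightarrow> x \<in> S"
  using subspace_add[of S "x - y" y] by simp

lemma lin_image_span_subset:
  assumes "lin f" "subspace S" "f ` X \<subseteq> S"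
  shows "f ` span X \<subseteq> S"
proof -
  have "span X \<subseteq> {v. f v \<in> S}"
    using assms lin_subspace_vimage by (intro span_minimal) auto
  then show ?thesis by auto
qed

lemma lin_eq_on_spanning:
  assumes "lin f" "lin g" "span X = UNIV" "\<And>x. x \<in> X \<Longrightarrow> f x = g x"
  shows "f v = g v"
proof -
  have "(\<lambda>v. f v - g v) ` span X \<subseteq> {0}"
    using assms by (intro lin_image_span_subset lin_minus) auto
  then show ?thesis using assms(3) by (auto simp: image_subset_iff)
qed

end

section \<open>Spectral resolutions\<close>

text \<open>A diagonalizable map together with its primitive idempotents. The locale serves
  \<open>A\<close>, \<open>As\<close> and also the maps that act as scalars on a split
  decomposition.\<close>

locale spectral = endomorphisms scale
  for scale :: "'a::field \<Rightarrow> 'b::ab_group_add \<Rightarrow> 'b" (infixr \<open>*s\<close> 75) +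
  fixes d :: nat and T :: "'b \<Rightarrow> 'b" and F :: "nat \<Rightarrow> 'b \<Rightarrow> 'b" and \<mu> :: "nat \<Rightarrow> 'a"
  assumes lin_T: "lin T"
    and lin_F: "i \<le> d \<Longrightarrow> lin (F i)"
    and F_F: "i \<le> d \<Longrightarrow> j \<le> d \<Longrightarrow> F i (F j v) = (if i = j then F j v else 0)"
    and F_sum: "(\<Sum>i\<le>d. F i v) = v"
    and T_F: "i \<le> d \<Longrightarrow> T (F i v) = \<mu> i *s F i v"
begin

lemma F_apply:
  assumes "lin g" "j \<le> d"
  shows "F j (g v) = (\<Sum>i\<le>d. F j (g (F i v)))"
proof -
  have "F j (g v) = F j (g (\<Sum>i\<le>d. F i v))" by (simp add: F_sum)
  also have "\<dots> = (\<Sum>i\<le>d. F j (g (F i v)))"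
    by (simp add: lin_sum[OF assms(1)] lin_sum[OF lin_F[OF assms(2)]])
  finally show ?thesis .
qed

lemma F_T:
  assumes "j \<le> d"
  shows "F j (T v) = \<mu> j *s F j v"
proof -
  have "F j (T v) = (\<Sum>i\<le>d. F j (\<mu> i *s F i v))"
    using F_apply[OF lin_T assms] by (simp add: T_F)
  also have "\<dots> = (\<Sum>i\<le>d. if i = j then \<mu> j *s F j v else 0)"
    by (rule sum.cong) (auto simp: lin_scale[OF lin_F] assms F_F)
  also have "\<dots> = \<mu> j *s F j v" using assms by simp
  finally show ?thesis .
qed

lemma F_eqI: "(\<And>j. j \<le> d \<Longrightarrow> F j v = F j w) \<Longrightarrow> v = w"
  by (metis (no_types, lifting) F_sum atMost_iff sum.cong)

lemma F_zeroI: "(\<And>j. j \<le> d \<Longrightarrow> F j v = 0) \<Longrightarrow> v = 0"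
  using F_eqI[of v 0] by (auto simp: lin_zero[OF lin_F])

text \<open>Expand \<open>v\<close> over the resolution: the distant components drop out by
  \<open>tri\<close>, the neighbouring ones by \<open>zero\<close>.\<close>

lemma F_tridiagonal:
  assumes "lin g" "j \<le> d"
    and tri: "\<And>i v. i \<le> d \<Longrightarrow> i + 1 < j \<or> j + 1 < i \<Longrightarrow> F j (g (F i v)) = 0"
    and zero: "\<And>i. i \<le> d \<Longrightarrow> i \<le> j + 1 \<Longrightarrow> j \<le> i + 1 \<Longrightarrow> F i v = 0"
  shows "F j (g v) = 0"
  unfolding F_apply[OF assms(1,2), of v]
proof (rule sum.neutral, safe)
  fix i assume "i \<le> d"
  then show "F j (g (F i v)) = 0"
    using tri[of i v] zero[of i] assms(1,2) by (cases "i + 1 < j \<or> j + 1 < i") (auto simp: lin_zero[OF assms(1)] lin_zero[OF lin_F])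
qed

lemma eigenvector_iff:
  assumes "inj_on \<mu> {..d}" "i \<le> d"
  shows "T v = \<mu> i *s v \<longleftrightarrow> F i v = v"
proof
  assume eq: "T v = \<mu> i *s v"
  show "F i v = v"
  proof (rule F_eqI)
    fix j assume j: "j \<le> d"
    have "\<mu> j *s F j v = \<mu> i *s F j v"
      using F_T[OF j, of v] unfolding eq lin_scale[OF lin_F[OF j]] by (rule sym)
    then have "\<mu> j = \<mu> i \<or> F j v = 0"
      by (simp only: scale_cancel_right)
    then have "j = i \<or> F j v = 0"
      using inj_onD[OF assms(1)] assms(2) j by auto
    then show "F j (F i v) = F j v" using j assms by (auto simp: F_F)
  qed
next
  assume "F i v = v"
  then show "T v = \<mu> i *s v" using T_F[OF assms(2), of v] by simp
qed

text \<open>Trades sums of eigenspaces for vanishing conditions on components, the form in which the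
  flags below are defined.\<close>

lemma sum_ranges:
  assumes "J \<subseteq> {..d}"
  shows "(\<Sum>j\<in>J. range (F j)) = {v. \<forall>j\<le>d. j \<notin> J \<longrightarrow> F j v = 0}"
proof -
  have J: "finite J" using finite_subset[OF assms] by simp
  show ?thesis
    unfolding set_sum_alt[OF J]
  proof safe
    fix s j assume s: "\<forall>i\<in>J. s i \<in> range (F i)" and j: "j \<le> d" "j \<notin> J"
    have "F j (s i) = 0" if i: "i \<in> J" for i
    proof -
      obtain t where "s i = F i t" using bspec[OF s i] by (rule rangeE)
      moreover have "i \<le> d" "i \<noteq> j" using i j assms by auto
      ultimately show ?thesis using j by (simp add: F_F)
    qed
    then show "F j (sum s J) = 0" by (simp add: lin_sum[OF lin_F[OF j(1)]])
  next
    fix v assume v: "\<forall>j\<le>d. j \<notin> J \<longrightarrow> F j v = 0"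
    have "(\<Sum>j\<in>J. F j v) = (\<Sum>j\<le>d. F j v)"
      using assms v by (intro sum.mono_neutral_left) auto
    also have "\<dots> = v" by (rule F_sum)
    finally have "v = (\<Sum>j\<in>J. F j v)" by (rule sym)
    then show "\<exists>s. v = sum s J \<and> (\<forall>i\<in>J. s i \<in> range (F i))"
      by (intro exI[of _ "\<lambda>j. F j v"] conjI ballI rangeI)
  qed
qed

lemma tridiagonal_standard_ordering:
  assumes "standard_ordering scale T B d (\<lambda>i. range (F i))"
    and "i \<le> d" "j \<le> d" "i + 1 < j \<or> j + 1 < i"
  shows "F j (B (F i v)) = 0"
proof -
  have J: "{i - 1..min (i + 1) d} \<subseteq> {..d}" by auto
  have "B (F i v) \<in> (\<Sum>j\<in>{i - 1..min (i + 1) d}. range (F j))"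
    using assms(1,2) unfolding standard_ordering_def by blast
  moreover have "j \<notin> {i - 1..min (i + 1) d}" using assms(4) by auto
  ultimately show ?thesis using assms(3) unfolding sum_ranges[OF J] by blast
qed

end

lemma (in endomorphisms) spectral_primitive_idempotents:
  fixes T :: "'b \<Rightarrow> 'b" and F :: "nat \<Rightarrow> 'b \<Rightarrow> 'b"
  defines "\<mu> \<equiv> \<lambda>i. eigenvalue_on scale T (range (F i))"
  assumes T: "lin T" "diagonalizable scale T"
    and F: "\<And>i. i \<le> d \<Longrightarrow> primitive_idempotent scale T (range (F i)) (F i)"
    and bij: "bij_betw (\<lambda>i. range (F i)) {0..d} (eigenspaces scale T)"
  shows "spectral scale d T F \<mu>" "inj_on \<mu> {..d}" "i \<le> d \<Longrightarrow> \<exists>v. F i v \<noteq> 0"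
proof -
  have lin_F: "lin (F i)" if "i \<le> d" for i
    using F[OF that] unfolding primitive_idempotent_def by blast
  have range: "range (F i) = eigenspace scale T (\<mu> i)" "\<exists>v. F i v \<noteq> 0" if i: "i \<le> d" for i
  proof -
    have "range (F i) \<in> eigenspaces scale T"
      using F[OF i] unfolding primitive_idempotent_def by blast
    then obtain t where t: "range (F i) = eigenspace scale T t" "range (F i) \<noteq> {0}"
      unfolding eigenspaces_def by blast
    show "\<exists>v. F i v \<noteq> 0"
    proof (rule ccontr)
      assume "\<nexists>v. F i v \<noteq> 0"
      then have "range (F i) = {0}" by auto
      then show False using t(2) by contradiction
    qed
    then obtain v where v: "F i v \<noteq> 0" by blast
    have "F i v \<in> eigenspace scale T t" using t(1) by blast
    then have Tv: "T (F i v) = t *s F i v" by (simp add: eigenspace_def)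
    \<comment> \<open>A nonzero vector in the eigenspace makes the eigenvalue unique, so the
      definite description in \<open>eigenvalue_on\<close> denotes \<open>t\<close>.\<close>
    have "\<mu> i = t"
      unfolding \<mu>_def eigenvalue_on_def
    proof (rule the_equality)
      show "\<forall>w\<in>range (F i). T w = t *s w" unfolding t(1) by (simp add: eigenspace_def)
      fix t' assume "\<forall>w\<in>range (F i). T w = t' *s w"
      then have "t' *s F i v = t *s F i v" using Tv by (metis rangeI)
      then show "t' = t" using v by simp
    qed
    then show "range (F i) = eigenspace scale T (\<mu> i)" using t(1) by simp
  qed
  then show "i \<le> d \<Longrightarrow> \<exists>v. F i v \<noteq> 0" by blast
  show "inj_on \<mu> {..d}"
  proof (rule inj_onI)
    fix i j assume "i \<in> {..d}" "j \<in> {..d}" "\<mu> i = \<mu> j"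
    then show "i = j"
      using range(1)[of i] range(1)[of j] inj_onD[OF bij_betw_imp_inj_on[OF bij], of i j] by simp
  qed
  have F_F: "F i (F j v) = (if i = j then F j v else 0)" if "i \<le> d" "j \<le> d" for i j v
  proof (cases "i = j")
    case True
    have "\<forall>w\<in>range (F i). F i w = w" using F[OF that(1)] unfolding primitive_idempotent_def by blast
    then show ?thesis using True by simp
  next
    case False
    then have "range (F j) \<noteq> range (F i)"
      using inj_onD[OF bij_betw_imp_inj_on[OF bij], of j i] that by auto
    moreover have "range (F j) \<in> eigenspaces scale T"
      using F[OF that(2)] unfolding primitive_idempotent_def by blast
    ultimately have "range (F j) \<in> eigenspaces scale T - {range (F i)}" by blast
    then have "\<forall>w\<in>range (F j). F i w = 0" using F[OF that(1)] unfolding primitive_idempotent_def by blast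
    then show ?thesis using False by simp
  qed
  \<comment> \<open>Completeness is checked on a spanning set of eigenvectors: a nonzero one lies in
    the range of some \<open>F k\<close> and is killed by the other idempotents.\<close>
  obtain X where X: "span X = UNIV" "\<And>v. v \<in> X \<Longrightarrow> \<exists>t. T v = t *s v"
    using T(2) by (auto simp: diagonalizable_def)
  have F_sum: "(\<Sum>i\<le>d. F i v) = v" for v
  proof (rule lin_eq_on_spanning[where f = "\<lambda>v. \<Sum>i\<le>d. F i v" and g = "\<lambda>v. v", OF _ lin_ident X(1)])
    show "lin (\<lambda>v. \<Sum>i\<le>d. F i v)" using lin_F by (intro lin_setsum) auto
    fix x assume "x \<in> X"
    then obtain t where t: "T x = t *s x" using X(2) by blast
    show "(\<Sum>i\<le>d. F i x) = x"
    proof (cases "x = 0")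
      case True
      then show ?thesis by (simp add: lin_zero[OF lin_F])
    next
      case False
      moreover have "x \<in> eigenspace scale T t" using t by (simp add: eigenspace_def)
      ultimately have "eigenspace scale T t \<in> eigenspaces scale T"
        unfolding eigenspaces_def by blast
      then have "eigenspace scale T t \<in> (\<lambda>i. range (F i)) ` {0..d}"
        using bij_betw_imp_surj_on[OF bij] by simp
      then obtain k where "k \<in> {0..d}" and k: "eigenspace scale T t = range (F k)"
        by (rule imageE)
      then have kd: "k \<le> d" by simp
      then have "x \<in> range (F k)" using t k by (auto simp: eigenspace_def)
      then obtain y where y: "x = F k y" by (rule rangeE)
      have "(\<Sum>i\<le>d. F i x) = (\<Sum>i\<le>d. if i = k then x else 0)"
        using kd by (intro sum.cong) (auto simp: y F_F)
      then show ?thesis using kd by simp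
    qed
  qed
  have T_F: "T (F i v) = \<mu> i *s F i v" if "i \<le> d" for i v
  proof -
    have "F i v \<in> eigenspace scale T (\<mu> i)" using range(1)[OF that] by blast
    then show ?thesis by (simp add: eigenspace_def)
  qed
  show "spectral scale d T F \<mu>"
    by (intro spectral.intro[OF endomorphisms_axioms] spectral_axioms.intro T(1) lin_F F_F F_sum T_F)
qed

section \<open>Flags and split decompositions\<close>

text \<open>A TD system in terms of components: \<open>tri_E\<close> and \<open>tri_Es\<close>
  express that the two orderings are standard.\<close>

locale td_flags = finite_dimensional_vector_space scale Basis + endomorphisms scale +
  R: spectral scale d A E \<theta> + S: spectral scale d As Es \<theta>s
  for scale :: "'a::field \<Rightarrow> 'b::ab_group_add \<Rightarrow> 'b" (infixr \<open>*s\<close> 75)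
    and Basis d A As E Es \<theta> \<theta>s +
  assumes tri_E: "i \<le> d \<Longrightarrow> j \<le> d \<Longrightarrow> i + 1 < j \<or> j + 1 < i \<Longrightarrow> E j (As (E i v)) = 0"
    and tri_Es: "i \<le> d \<Longrightarrow> j \<le> d \<Longrightarrow> i + 1 < j \<or> j + 1 < i \<Longrightarrow> Es j (A (Es i v)) = 0"
    and E_nonzero: "i \<le> d \<Longrightarrow> \<exists>v. E i v \<noteq> 0"
    and Es_nonzero: "i \<le> d \<Longrightarrow> \<exists>v. Es i v \<noteq> 0"
    and irreducible: "subspace W \<Longrightarrow> A ` W \<subseteq> W \<Longrightarrow> As ` W \<subseteq> W \<Longrightarrow> W = {0} \<or> W = UNIV"
begin

text \<open>\<open>L n\<close> is the sum of the first \<open>n\<close> eigenspaces of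
  \<open>As\<close>; the strict bound makes \<open>L 0\<close> zero and \<open>L (Suc d)\<close>
  everything. \<open>H n\<close> is the sum of the eigenspaces of \<open>A\<close> from index
  \<open>n\<close> on.\<close>

definition L :: "nat \<Rightarrow> 'b set" where
  "L n = {v. \<forall>j\<le>d. n \<le> j \<longrightarrow> Es j v = 0}"

definition H :: "nat \<Rightarrow> 'b set" where
  "H n = {v. \<forall>j\<le>d. j < n \<longrightarrow> E j v = 0}"

definition U :: "nat \<Rightarrow> 'b set" where
  "U n = L (Suc n) \<inter> H n"

lemma subspace_L: "subspace (L n)"
  by (rule subspaceI) (auto simp: L_def lin_simps[OF S.lin_F])

lemma subspace_H: "subspace (H n)"
  by (rule subspaceI) (auto simp: H_def lin_simps[OF R.lin_F])

lemma subspace_U: "subspace (U n)"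
  unfolding U_def by (intro subspace_inter subspace_L subspace_H)

lemma L_mono: "m \<le> n \<Longrightarrow> L m \<subseteq> L n" and H_antimono: "m \<le> n \<Longrightarrow> H n \<subseteq> H m"
  by (auto simp: L_def H_def)

lemma L_0: "L 0 = {0}"
  by (auto simp: L_def lin_zero[OF S.lin_F] intro: S.F_zeroI)

lemma L_top: "d < n \<Longrightarrow> L n = UNIV"
  by (auto simp: L_def)

lemma H_0: "H 0 = UNIV"
  by (auto simp: H_def)

lemma H_top: "d < n \<Longrightarrow> H n = {0}"
  by (auto simp: H_def lin_zero[OF R.lin_F] intro: R.F_zeroI)

text \<open>This fact and the next hold because subtracting the eigenvalue kills the one component
  to be removed; \<open>As_H\<close> and \<open>A_L\<close> hold because tridiagonality spreads
  components by at most one index.\<close>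

lemma A_minus_H: "v \<in> H n \<Longrightarrow> A v - \<theta> n *s v \<in> H (Suc n)"
  by (auto simp: H_def R.F_T lin_simps[OF R.lin_F] less_Suc_eq)

lemma As_minus_L: "v \<in> L (Suc n) \<Longrightarrow> As v - \<theta>s n *s v \<in> L n"
  by (auto simp: L_def S.F_T lin_simps[OF S.lin_F] Suc_le_eq le_less)

lemma As_H: "v \<in> H (Suc n) \<Longrightarrow> As v \<in> H n"
  unfolding H_def
  by (auto intro!: R.F_tridiagonal[OF S.lin_T] tri_E)

lemma A_L: "v \<in> L n \<Longrightarrow> A v \<in> L (Suc n)"
  unfolding L_def
  by (auto intro!: S.F_tridiagonal[OF R.lin_T] tri_Es)

text \<open>The case \<open>r = 0\<close> is the sum of the split subspaces, the case
  \<open>r = 1\<close> the sum of the \<open>L n \<inter> H n\<close> with \<open>n \<ge> 1\<close>.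
  Irreducibility applied to these two yields spanning and trivial intersection.\<close>

definition W :: "nat \<Rightarrow> 'b set" where
  "W r = span (\<Union>i. L (Suc i) \<inter> H (i + r))"

lemma A_W: "A ` W r \<subseteq> W r"
  unfolding W_def
proof (rule lin_image_span_subset[OF R.lin_T subspace_span], safe)
  fix i v assume v: "v \<in> L (Suc i)" "v \<in> H (i + r)"
  \<comment> \<open>\<open>A - \<theta> (i + r)\<close> moves a generator of index \<open>i\<close>
    to index \<open>i + 1\<close>.\<close>
  then have "A v - \<theta> (i + r) *s v \<in> L (Suc (Suc i)) \<inter> H (Suc i + r)"
    using A_minus_H[of v "i + r"] A_L[of v "Suc i"] L_mono[of "Suc i" "Suc (Suc i)"]
    by (auto intro!: subspace_diff subspace_scale subspace_L)
  then have "A v - \<theta> (i + r) *s v \<in> span (\<Union>i. L (Suc i) \<inter> H (i + r))"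
    by (intro span_base UN_I[of "Suc i"]) simp_all
  moreover have "\<theta> (i + r) *s v \<in> span (\<Union>i. L (Suc i) \<inter> H (i + r))"
    using v by (intro span_scale span_base UN_I[of i]) simp_all
  ultimately show "A v \<in> span (\<Union>i. L (Suc i) \<inter> H (i + r))"
    by (rule subspace_diff_memD[OF subspace_span])
qed

lemma As_W: "As ` W r \<subseteq> W r"
  unfolding W_def
proof (rule lin_image_span_subset[OF S.lin_T subspace_span], safe)
  fix i v assume v: "v \<in> L (Suc i)" "v \<in> H (i + r)"
  \<comment> \<open>\<open>As - \<theta>s i\<close> moves a generator of index \<open>i\<close> to
    index \<open>i - 1\<close>, and to zero when \<open>i = 0\<close>.\<close>
  have "As v - \<theta>s i *s v \<in> span (\<Union>i. L (Suc i) \<inter> H (i + r))"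
  proof (cases i)
    case 0
    then show ?thesis using As_minus_L[OF v(1)] by (simp add: L_0 span_zero)
  next
    case (Suc k)
    then have "As v - \<theta>s i *s v \<in> L (Suc k) \<inter> H (k + r)"
      using As_minus_L[OF v(1)] v As_H[of v "k + r"] H_antimono[of "k + r" "Suc (k + r)"]
      by (auto intro!: subspace_diff subspace_scale subspace_H)
    then show ?thesis by (intro span_base UN_I[of k]) simp_all
  qed
  moreover have "\<theta>s i *s v \<in> span (\<Union>i. L (Suc i) \<inter> H (i + r))"
    using v by (intro span_scale span_base UN_I[of i]) simp_all
  ultimately show "As v \<in> span (\<Union>i. L (Suc i) \<inter> H (i + r))"
    by (rule subspace_diff_memD[OF subspace_span])
qed

lemma W_cases: "W r = {0} \<or> W r = UNIV"
  using irreducible[OF _ A_W As_W] by (simp add: W_def)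

lemma L_Int_H: "v \<in> L n \<Longrightarrow> v \<in> H n \<Longrightarrow> v = 0"
proof (cases n)
  case (Suc k)
  assume v: "v \<in> L n" "v \<in> H n"
  \<comment> \<open>Vectors in \<open>H 1\<close> have no component at index 0, so
    \<open>W 1\<close> is proper and must be zero.\<close>
  have "W 1 \<subseteq> H 1"
    unfolding W_def by (rule span_minimal) (use H_antimono[of 1] subspace_H in auto)
  moreover have "H 1 \<noteq> UNIV"
    using E_nonzero[of 0] by (auto simp: H_def)
  ultimately have "W 1 = {0}" using W_cases[of 1] by auto
  moreover have "v \<in> W 1"
    unfolding W_def using v Suc by (intro span_base UN_I[of k]) simp_all
  ultimately show ?thesis by simp
qed (simp add: L_0)

lemma span_U: "span (\<Union>i\<le>d. U i) = UNIV"
proof -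
  \<comment> \<open>The range of \<open>Es 0\<close> lies in \<open>L 1 \<inter> H 0\<close>, so
    \<open>W 0\<close> is not zero.\<close>
  obtain v where "Es 0 v \<noteq> 0" using Es_nonzero[of 0] by auto
  moreover have "Es 0 v \<in> W 0"
    unfolding W_def by (intro span_base UN_I[of 0]) (simp_all add: L_def H_def S.F_F)
  ultimately have "W 0 = UNIV" using W_cases[of 0] by auto
  moreover have "W 0 \<subseteq> span (\<Union>i\<le>d. U i)"
    unfolding W_def
  proof (rule span_minimal[OF _ subspace_span], safe)
    fix i v assume v: "v \<in> L (Suc i)" "v \<in> H (i + 0)"
    show "v \<in> span (\<Union>i\<le>d. U i)"
    proof (cases "i \<le> d")
      case True
      then show ?thesis using v by (intro span_base UN_I[of i]) (simp_all add: U_def)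
    next
      case False
      then have "v = 0" using v(2) by (simp add: H_top)
      then show ?thesis by (simp only: span_zero)
    qed
  qed
  ultimately show ?thesis by auto
qed

section \<open>Projections onto the split summands\<close>

lemma L_plus_H: "\<exists>x\<in>L n. v - x \<in> H n"
proof -
  let ?S = "{v. \<exists>x\<in>L n. v - x \<in> H n}"
  have "subspace ?S"
  proof (rule subspaceI)
    show "0 \<in> ?S"
      using subspace_0[OF subspace_L[of n]] subspace_0[OF subspace_H[of n]] by (auto intro!: bexI[of _ 0])
    fix v w assume "v \<in> ?S" "w \<in> ?S"
    then obtain x y where "x \<in> L n" "v - x \<in> H n" "y \<in> L n" "w - y \<in> H n" by auto
    then show "v + w \<in> ?S"
      using subspace_add[OF subspace_L, of x n y] subspace_add[OF subspace_H, of "v - x" n "w - y"]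
      by (auto simp: algebra_simps intro!: bexI[of _ "x + y"])
  next
    fix c v assume "v \<in> ?S"
    then obtain x where "x \<in> L n" "v - x \<in> H n" by auto
    then show "c *s v \<in> ?S"
      using subspace_scale[OF subspace_L, of x n c] subspace_scale[OF subspace_H, of "v - x" n c]
      by (auto simp: scale_right_diff_distrib)
  qed
  moreover have "(\<Union>i\<le>d. U i) \<subseteq> ?S"
  proof safe
    fix i v assume v: "v \<in> U i"
    \<comment> \<open>Each \<open>U i\<close> lies entirely in \<open>L n\<close> or entirely in
      \<open>H n\<close>.\<close>
    show "\<exists>x\<in>L n. v - x \<in> H n"
    proof (cases "i < n")
      case True
      then have "v \<in> L n" using v L_mono[of "Suc i" n] by (auto simp: U_def)
      then show ?thesis by (intro bexI[of _ v]) (simp_all add: subspace_0 subspace_H)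
    next
      case False
      then have "v \<in> H n" using v H_antimono[of n i] by (auto simp: U_def)
      then show ?thesis by (intro bexI[of _ 0]) (simp_all add: subspace_0 subspace_L)
    qed
  qed
  ultimately have "span (\<Union>i\<le>d. U i) \<subseteq> ?S" by (intro span_minimal)
  then show ?thesis unfolding span_U by auto
qed

text \<open>The projection onto \<open>L n\<close> along \<open>H n\<close>; the choice is unique
  because these meet only in zero.\<close>

definition P :: "nat \<Rightarrow> 'b \<Rightarrow> 'b" where
  "P n v = (SOME x. x \<in> L n \<and> v - x \<in> H n)"

lemma P_L: "P n v \<in> L n" and P_H: "v - P n v \<in> H n"
  using someI_ex[of "\<lambda>x. x \<in> L n \<and> v - x \<in> H n"] L_plus_H[of n v] by (auto simp: P_def)

lemma P_eqI: "x \<in> L n \<Longrightarrow> v - x \<in> H n \<Longrightarrow> P n v = x"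
proof -
  assume x: "x \<in> L n" "v - x \<in> H n"
  have "P n v - x \<in> L n" using x P_L by (intro subspace_diff subspace_L)
  moreover have "P n v - x \<in> H n"
    using subspace_diff[OF subspace_H x(2) P_H[of v n]] by simp
  ultimately show ?thesis using L_Int_H by fastforce
qed

lemma lin_P: "lin (P n)"
proof (rule linI)
  fix v w c
  show "P n (v + w) = P n v + P n w"
    using subspace_add[OF subspace_H P_H[of v n] P_H[of w n]]
    by (intro P_eqI subspace_add subspace_L P_L) (simp add: algebra_simps)
  show "P n (c *s v) = c *s P n v"
    using subspace_scale[OF subspace_H P_H[of v n], of c]
    by (intro P_eqI subspace_scale subspace_L P_L) (simp add: scale_right_diff_distrib)
qed

lemma P_on_L: "v \<in> L n \<Longrightarrow> P n v = v" and P_on_H: "v \<in> H n \<Longrightarrow> P n v = 0"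
  by (auto intro!: P_eqI subspace_0 subspace_L subspace_H)

text \<open>Consecutive flag projections differ by the projection onto \<open>U i\<close> along the
  other summands, so sums over \<open>i\<close> telescope.\<close>

definition pr :: "nat \<Rightarrow> 'b \<Rightarrow> 'b" where
  "pr i v = P (Suc i) v - P i v"

lemma lin_pr: "lin (pr i)"
  unfolding pr_def by (intro lin_minus lin_P)

lemma pr_U: "pr i v \<in> U i"
proof -
  have "pr i v \<in> L (Suc i)"
    unfolding pr_def using P_L[of i v] L_mono[of i "Suc i"]
    by (intro subspace_diff[OF subspace_L] P_L) auto
  moreover have "(v - P i v) - (v - P (Suc i) v) \<in> H i"
    using subspace_diff[OF subspace_H P_H[of v i], of "v - P (Suc i) v"]
      P_H[of v "Suc i"] H_antimono[OF Suc_leD[OF order_refl], of i] by blast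
  ultimately show ?thesis by (simp add: U_def pr_def)
qed

lemma pr_on_U: "v \<in> U j \<Longrightarrow> pr i v = (if i = j then v else 0)"
proof -
  assume v: "v \<in> U j"
  have "P n v = (if j < n then v else 0)" for n
    using v L_mono[of "Suc j" n] H_antimono[of n j] P_on_L[of v n] P_on_H[of v n]
    by (cases "j < n") (auto simp: U_def)
  then show ?thesis by (auto simp: pr_def)
qed

lemma sum_pr: "(\<Sum>i\<le>d. pr i v) = v"
proof -
  have "(\<Sum>i\<le>d. pr i v) = P (Suc d) v - P 0 v"
    unfolding pr_def lessThan_Suc_atMost[symmetric] by (rule sum_lessThan_telescope)
  then show ?thesis by (simp add: P_on_L L_top P_on_H H_0)
qed

lemma lin_eq_on_U:
  "lin f \<Longrightarrow> lin g \<Longrightarrow> (\<And>i u. i \<le> d \<Longrightarrow> u \<in> U i \<Longrightarrow> f u = g u) \<Longrightarrow> f v = g v"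
  by (rule lin_eq_on_spanning[OF _ _ span_U]) auto

definition diag_U :: "(nat \<Rightarrow> 'a) \<Rightarrow> 'b \<Rightarrow> 'b" where
  "diag_U c v = (\<Sum>i\<le>d. c i *s pr i v)"

lemma lin_diag_U: "lin (diag_U c)"
  unfolding diag_U_def by (intro lin_setsum lin_scale_right lin_pr)

lemma diag_U_on_U:
  assumes "i \<le> d" "u \<in> U i"
  shows "diag_U c u = c i *s u"
proof -
  have "diag_U c u = (\<Sum>j\<le>d. if j = i then c i *s u else 0)"
    unfolding diag_U_def by (rule sum.cong) (auto simp: pr_on_U[OF assms(2)])
  then show ?thesis using assms(1) by simp
qed

lemma spectral_diag_U: "spectral scale d (diag_U c) pr c"
  by (intro spectral.intro[OF endomorphisms_axioms] spectral_axioms.intro)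
    (simp_all add: lin_diag_U lin_pr sum_pr pr_on_U[OF pr_U] diag_U_on_U[OF _ pr_U])

lemma diag_U_eigenvector:
  assumes "inj_on c {..d}" "i \<le> d" "diag_U c v = c i *s v"
  shows "v \<in> U i"
  using spectral.eigenvector_iff[OF spectral_diag_U assms(1,2), of v] assms(3) pr_U[of i v] by simp

lemma diag_U_L: "v \<in> L n \<Longrightarrow> diag_U c v \<in> L n"
  unfolding diag_U_def
proof (rule subspace_sum[OF subspace_L])
  fix i assume v: "v \<in> L n"
  show "c i *s pr i v \<in> L n"
  proof (cases "Suc i \<le> n")
    case True
    then show ?thesis
      using pr_U[of i v] L_mono[of "Suc i" n] subspace_scale[OF subspace_L] by (auto simp: U_def)
  next
    case False
    \<comment> \<open>For \<open>i \<ge> n\<close> both flag projections fix \<open>v\<close>, so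
      \<open>pr i v\<close> is zero.\<close>
    then have "v \<in> L i" "v \<in> L (Suc i)" using v L_mono[of n i] L_mono[of n "Suc i"] by auto
    then show ?thesis by (simp add: pr_def P_on_L subspace_0 subspace_L)
  qed
qed

text \<open>The map acts on the quotient of \<open>L (Suc n)\<close> by \<open>L n\<close> as the
  scalar \<open>c n\<close>: \<open>v\<close> is \<open>pr n v\<close> plus a vector of
  \<open>L n\<close>, which is preserved.\<close>

lemma diag_U_minus_L:
  assumes "n \<le> d" "v \<in> L (Suc n)"
  shows "diag_U c v - c n *s v \<in> L n"
proof -
  have "v = pr n v + P n v" using assms by (simp add: pr_def P_on_L)
  then have "diag_U c v - c n *s v = diag_U c (P n v) - c n *s P n v"
    using lin_add[OF lin_diag_U, of c "pr n v" "P n v"] diag_U_on_U[OF assms(1) pr_U, of c v]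
      scale_right_distrib[of "c n" "pr n v" "P n v"] by simp
  then show ?thesis
    by (simp add: subspace_diff subspace_scale subspace_L diag_U_L P_L)
qed

text \<open>Listing the eigenspaces of \<open>A\<close> backwards keeps the flag \<open>L\<close>
  and turns the summands \<open>U i\<close> into those of the second split decomposition. Every
  result thus holds for both decompositions.\<close>

lemma reversed:
  "td_flags scale Basis d A As (\<lambda>i. E (d - i)) Es (\<lambda>i. \<theta> (d - i)) \<theta>s"
proof -
  have "(\<Sum>i\<le>d. E (d - i) v) = (\<Sum>i\<le>d. E i v)" for v
    by (rule sum.reindex_bij_witness[of _ "\<lambda>i. d - i" "\<lambda>i. d - i"]) auto
  then have "spectral scale d A (\<lambda>i. E (d - i)) (\<lambda>i. \<theta> (d - i))"
    by (intro spectral.intro[OF endomorphisms_axioms] spectral_axioms.intro)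
      (auto simp: R.lin_T R.lin_F R.F_F R.T_F R.F_sum)
  moreover have "td_flags_axioms scale d A As (\<lambda>i. E (d - i)) Es"
    by (rule td_flags_axioms.intro) (auto intro: tri_E tri_Es E_nonzero Es_nonzero dest: irreducible)
  ultimately show ?thesis
    by (intro td_flags.intro finite_dimensional_vector_space_axioms endomorphisms_axioms
        S.spectral_axioms)
qed

section \<open>Dimensions of the split summands\<close>

lemma dim_image_inj:
  assumes "lin f" "subspace S" "\<And>x. x \<in> S \<Longrightarrow> f x = 0 \<Longrightarrow> x = 0"
  shows "dim (f ` S) = dim S"
proof -
  interpret fp: finite_dimensional_vector_space_pair scale Basis scale Basis by unfold_locales
  have "inj_on f S"
    using assms module_hom.inj_on_iff_eq_0[OF lin_hom[OF assms(1)] assms(2)] by blast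
  then show ?thesis
    using assms(1,2) by (intro fp.dim_image_eq) (simp_all add: span_eq_iff[THEN iffD2])
qed

text \<open>\<open>U i\<close> is a complement of \<open>H (Suc i)\<close> in \<open>H i\<close>, so
  \<open>E i\<close> maps it isomorphically onto its range. For \<open>Es i\<close> the same works
  with \<open>L i\<close> inside \<open>L (Suc i)\<close>.\<close>

lemma dim_U_E:
  assumes "i \<le> d"
  shows "dim (U i) = dim (range (E i))"
proof -
  have "E i ` U i = range (E i)"
  proof safe
    fix v
    have "E i v \<in> H i" using assms by (auto simp: H_def R.F_F)
    then have w: "E i v - P (Suc i) (E i v) \<in> H (Suc i)" "P (Suc i) (E i v) \<in> H i"
      using P_H[of "E i v" "Suc i"] H_antimono[OF Suc_leD[OF order_refl], of i]
        subspace_diff[OF subspace_H, of "E i v" i "E i v - P (Suc i) (E i v)"] by auto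
    then have "P (Suc i) (E i v) \<in> U i" by (auto simp: U_def P_L)
    moreover have "E i v = E i (P (Suc i) (E i v))"
      using w(1) assms by (auto simp: H_def lin_diff[OF R.lin_F] R.F_F)
    ultimately show "E i v \<in> E i ` U i" by blast
  qed auto
  moreover have "dim (E i ` U i) = dim (U i)"
  proof (rule dim_image_inj[OF R.lin_F[OF assms] subspace_U])
    fix x assume "x \<in> U i" "E i x = 0"
    then have "x \<in> H (Suc i)" "x \<in> L (Suc i)" by (auto simp: U_def H_def less_Suc_eq)
    then show "x = 0" using L_Int_H by blast
  qed
  ultimately show ?thesis by simp
qed

lemma dim_U_Es:
  assumes "i \<le> d"
  shows "dim (U i) = dim (range (Es i))"
proof -
  have "Es i ` U i = range (Es i)"
  proof safe
    fix v
    have L: "Es i v \<in> L (Suc i)" using assms by (auto simp: L_def S.F_F)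
    have "Es i v - P i (Es i v) \<in> L (Suc i)"
      using subspace_diff[OF subspace_L L] P_L[of i "Es i v"] L_mono[of i "Suc i"] by auto
    then have "Es i v - P i (Es i v) \<in> U i" by (auto simp: U_def P_H)
    moreover have "Es i v = Es i (Es i v - P i (Es i v))"
      using P_L[of i "Es i v"] assms by (auto simp: L_def lin_diff[OF S.lin_F] S.F_F)
    ultimately show "Es i v \<in> Es i ` U i" by blast
  qed auto
  moreover have "dim (Es i ` U i) = dim (U i)"
  proof (rule dim_image_inj[OF S.lin_F[OF assms] subspace_U])
    fix x assume "x \<in> U i" "Es i x = 0"
    then have "x \<in> H i" "x \<in> L i" by (auto simp: U_def L_def le_less Suc_le_eq)
    then show "x = 0" using L_Int_H by blast
  qed
  ultimately show ?thesis by simp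
qed

end

section \<open>Raising along the split decomposition and generators of \<open>V\<close> as an
  \<open>A\<close>-module\<close>

context td_flags
begin

interpretation D: td_flags scale Basis d A As "\<lambda>i. E (d - i)" Es "\<lambda>i. \<theta> (d - i)" \<theta>s
  by (rule reversed)

text \<open>\<open>U (d - i)\<close> and \<open>D.U i\<close> both have the rank of
  \<open>E (d - i)\<close> as dimension; \<open>D.U i\<close> and \<open>U i\<close> both have the
  rank of \<open>Es i\<close>.\<close>

lemma dim_U_sym:
  assumes "i \<le> d"
  shows "dim (U (d - i)) = dim (U i)"
  using dim_U_E[of "d - i"] D.dim_U_E[of i] D.dim_U_Es[of i] dim_U_Es[of i] assms by simp

text \<open>The product of the factors \<open>A - \<theta> k\<close> with
  \<open>i \<le> k < i + n\<close>.\<close>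

fun rise :: "nat \<Rightarrow> nat \<Rightarrow> 'b \<Rightarrow> 'b" where
  "rise i 0 v = v"
| "rise i (Suc n) v = rise (Suc i) n (A v - \<theta> i *s v)"

lemma lin_rise: "lin (rise i n)"
proof (induct n arbitrary: i)
  case 0
  then show ?case using lin_ident by simp
next
  case (Suc n)
  have "lin (\<lambda>v. A v - \<theta> i *s v)"
    by (intro lin_minus lin_scale_right lin_ident R.lin_T)
  from lin_compose[OF Suc this] show ?case by simp
qed

lemma A_minus_U: "u \<in> U i \<Longrightarrow> A u - \<theta> i *s u \<in> U (Suc i)"
  using A_minus_H[of u i] A_L[of u "Suc i"] L_mono[of "Suc i" "Suc (Suc i)"]
  by (auto simp: U_def intro!: subspace_diff subspace_scale subspace_L)

lemma rise_U: "u \<in> U i \<Longrightarrow> rise i n u \<in> U (i + n)"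
proof (induct n arbitrary: i u)
  case (Suc n)
  from Suc(1)[OF A_minus_U[OF Suc(2)]] show ?case by simp
qed simp

lemma rise_invariant:
  assumes "subspace Z" "A ` Z \<subseteq> Z" "v \<in> Z"
  shows "rise i n v \<in> Z"
  using assms(3)
proof (induct n arbitrary: i v)
  case (Suc n)
  have "A v - \<theta> i *s v \<in> Z"
    using Suc(2) assms(1,2) by (intro subspace_diff subspace_scale) auto
  then show ?case using Suc(1) by simp
qed simp

text \<open>On the eigenspace of index \<open>j\<close> the product is the scalar with factors
  \<open>\<theta> j - \<theta> k\<close>, nonzero when \<open>j\<close> lies outside the
  window.\<close>

lemma rise_kernel:
  assumes "inj_on \<theta> {..d}" "i + n \<le> Suc d" "rise i n v = 0" "j \<le> d" "j < i \<or> i + n \<le> j"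
  shows "E j v = 0"
  using assms(2,3,5)
proof (induct n arbitrary: i v)
  case 0
  then show ?case using lin_zero[OF R.lin_F[OF assms(4)]] by simp
next
  case (Suc n)
  have "E j (A v - \<theta> i *s v) = 0"
    using Suc(2-4) by (intro Suc(1)[of "Suc i"]) auto
  then have "(\<theta> j - \<theta> i) *s E j v = 0"
    using assms(4) by (simp add: lin_simps[OF R.lin_F] R.F_T scale_left_diff_distrib)
  moreover have "\<theta> j \<noteq> \<theta> i"
    using inj_onD[OF assms(1), of j i] assms(4) Suc(2,4) by auto
  ultimately show ?case by simp
qed

text \<open>The window of a kernel vector misses the last \<open>i + 1\<close> indices because
  \<open>2 * i + n \<le> d\<close>. The vector thus lies in \<open>D.H (Suc i)\<close>, which meets
  \<open>L (Suc i)\<close> trivially.\<close>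

lemma rise_inj:
  assumes "inj_on \<theta> {..d}" "2 * i + n \<le> d" "u \<in> U i" "rise i n u = 0"
  shows "u = 0"
proof -
  have "u \<in> D.H (Suc i)"
    unfolding D.H_def
  proof safe
    fix j assume "j \<le> d" "j < Suc i"
    then show "E (d - j) u = 0"
      using assms(2) by (intro rise_kernel[OF assms(1) _ assms(4)]) auto
  qed
  then show ?thesis using D.L_Int_H[of u "Suc i"] assms(3) by (simp add: U_def)
qed

text \<open>\<open>d - 2 * i\<close> is the largest length allowed in \<open>rise_inj\<close>, and
  injectivity between spaces of equal dimension gives surjectivity.\<close>

lemma rise_image:
  assumes "inj_on \<theta> {..d}" "2 * i \<le> d"
  shows "rise i (d - 2 * i) ` U i = U (d - i)"
proof (rule subspace_dim_equal)
  show "subspace (rise i (d - 2 * i) ` U i)"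
    by (rule module_hom.subspace_image[OF lin_hom[OF lin_rise] subspace_U])
  have eq: "i + (d - 2 * i) = d - i" using assms(2) by simp
  show "rise i (d - 2 * i) ` U i \<subseteq> U (d - i)"
    using rise_U[of _ i "d - 2 * i"] unfolding eq by blast
  have "dim (rise i (d - 2 * i) ` U i) = dim (U i)"
  proof (rule dim_image_inj[OF lin_rise subspace_U])
    fix x assume "x \<in> U i" "rise i (d - 2 * i) x = 0"
    then show "x = 0" using rise_inj[OF assms(1), of i "d - 2 * i" x] assms(2) by simp
  qed
  then show "dim (U (d - i)) \<le> dim (rise i (d - 2 * i) ` U i)"
    using dim_U_sym[of i] assms(2) by simp
qed (rule subspace_U)

text \<open>With one factor more than in \<open>rise_image\<close> the window is
  \<open>i..d - i\<close>, so a kernel vector has no component of index above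
  \<open>d - i\<close>.\<close>

lemma rise_kernel_U:
  assumes "inj_on \<theta> {..d}" "2 * i \<le> d" "u \<in> U i" "rise i (Suc (d - 2 * i)) u = 0"
  shows "u \<in> D.U i"
proof -
  have "u \<in> D.H i"
    unfolding D.H_def
  proof safe
    fix j assume "j \<le> d" "j < i"
    then show "E (d - j) u = 0"
      using assms(2) by (intro rise_kernel[OF assms(1) _ assms(4)]) auto
  qed
  then show ?thesis using assms(3) by (simp add: U_def D.U_def)
qed

text \<open>
  As an \<open>A\<close>-module, \<open>V\<close> is generated by the subspaces \<open>U i \<inter> D.U i\<close>: since \<open>rise\<close> maps
  \<open>U (j - 1)\<close> onto \<open>U (d - j + 1)\<close>, each \<open>u \<in> U j\<close> with \<open>2 j \<le> d\<close> can be corrected by an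
  element of \<open>(A - \<theta> (j - 1)) U (j - 1)\<close> so that it lies in the kernel of
  \<open>rise j (d - 2 j + 1)\<close>.
\<close>

lemma generated_UNIV:
  assumes inj: "inj_on \<theta> {..d}" and Z: "subspace Z" "A ` Z \<subseteq> Z"
    and base: "\<And>i v. 2 * i \<le> d \<Longrightarrow> v \<in> U i \<Longrightarrow> v \<in> D.U i \<Longrightarrow> v \<in> Z"
  shows "v \<in> Z"
proof -
  have low: "U j \<subseteq> Z" if "2 * j \<le> d" for j
    using that
  proof (induct j)
    case 0
    show ?case
    proof
      fix u assume u: "u \<in> U 0"
      \<comment> \<open>Raising \<open>d + 1\<close> times leads past the last summand, hence to
        zero.\<close>
      have "rise 0 (Suc d) u \<in> H (Suc d)"
        using rise_U[OF u, of "Suc d"] by (simp add: U_def)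
      then have "rise 0 (Suc (d - 2 * 0)) u = 0" by (simp add: H_top)
      from rise_kernel_U[OF inj _ u this] base[of 0] u show "u \<in> Z" by auto
    qed
  next
    case (Suc j)
    show ?case
    proof
      fix u assume u: "u \<in> U (Suc j)"
      define n where "n = d - 2 * Suc j"
      have n: "d - 2 * j = Suc (Suc n)" "Suc j + Suc n = d - j" using Suc(2) by (auto simp: n_def)
      have "rise (Suc j) (Suc n) u \<in> U (d - j)" using rise_U[OF u, of "Suc n"] by (simp only: n)
      also have "U (d - j) = rise j (Suc (Suc n)) ` U j"
        using rise_image[OF inj, of j] Suc(2) n by simp
      finally obtain w where w: "w \<in> U j" "rise (Suc j) (Suc n) u = rise (Suc j) (Suc n) (A w - \<theta> j *s w)"
        by (auto simp del: rise.simps(2) simp: rise.simps(2)[of j "Suc n"])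
      have "w \<in> Z" using Suc w by auto
      then have wZ: "A w - \<theta> j *s w \<in> Z" using Z by (intro subspace_diff subspace_scale) auto
      have "rise (Suc j) (Suc n) (u - (A w - \<theta> j *s w)) = 0"
        using w(2) by (simp only: lin_diff[OF lin_rise] right_minus_eq)
      moreover have uw: "u - (A w - \<theta> j *s w) \<in> U (Suc j)"
        by (rule subspace_diff[OF subspace_U u A_minus_U[OF w(1)]])
      ultimately have "u - (A w - \<theta> j *s w) \<in> Z"
        using Suc(2) by (intro base[of "Suc j"] rise_kernel_U inj) (simp_all only: n_def)
      then show "u \<in> Z" using wZ by (rule subspace_diff_memD[OF Z(1)])
    qed
  qed
  have "U j \<subseteq> Z" if "j \<le> d" for j
  proof (cases "2 * j \<le> d")
    case False
    \<comment> \<open>A summand in the upper half is the raised image of its mirror in the lower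
      half.\<close>
    then have "U j = rise (d - j) (d - 2 * (d - j)) ` U (d - j)"
      using rise_image[OF inj, of "d - j"] that by simp
    moreover have "U (d - j) \<subseteq> Z" using low False by simp
    ultimately show ?thesis using rise_invariant[OF Z] by auto
  qed (rule low)
  then have "span (\<Union>i\<le>d. U i) \<subseteq> Z" by (intro span_minimal Z) auto
  then show ?thesis unfolding span_U by auto
qed

end

section \<open>The identity that carries the quadratic relation from \<open>v\<close> to
  \<open>A v\<close>\<close>

context endomorphisms
begin

text \<open>
  If \<open>Q\<close> denotes the quadratic expression in \<open>K, B\<close> below, then
  \<open>Q A = r\<^sup>2 A Q + s (Q (\<alpha> K + \<beta> B) + (\<gamma> K + \<delta> B) Q)\<close> for suitable scalars; the
  coefficients are found by comparing the eight cubic monomials in \<open>K, B\<close>.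
\<close>

lemma quadratic_relation_step:
  fixes q a :: 'a
  defines "h \<equiv> q - inverse q" and "u \<equiv> inverse a * q - a * inverse q"
    and "w \<equiv> a * q - inverse a * inverse q"
    and "r \<equiv> inverse q ^ 2" and "s \<equiv> 1 - inverse q ^ 2"
  assumes lin: "lin A" "lin K" "lin B" and nz: "q \<noteq> 0" "a \<noteq> 0" "inverse a \<noteq> a"
    and KA: "\<And>x. K (A x) = r *s A (K x) + (s * a) *s K (K x) + (s * inverse a) *s x"
    and BA: "\<And>x. B (A x) = r *s A (B x) + (s * inverse a) *s B (B x) + (s * a) *s x"
    and Q_def: "\<And>x. Q x = (h * a) *s K (K x) - u *s K (B x) - w *s B (K x)
      + (h * inverse a) *s B (B x)"
    and Q: "Q v = 0" "Q (K v) = 0" "Q (B v) = 0"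
  shows "Q (A v) = 0"
proof -
  \<comment> \<open>Multiplying by \<open>e\<close> clears the common denominator of the four
    coefficients; \<open>e\<close> is nonzero because \<open>inverse a \<noteq> a\<close>, and it is
    cancelled at the end.\<close>
  define a' e where "a' = inverse a" and "e = inverse a - a"
  define \<alpha> \<beta> \<gamma> \<delta> where "\<alpha> = - w * a * inverse q" and "\<beta> = u * a' * inverse q"
    and "\<gamma> = u * a * inverse q" and "\<delta> = - w * a' * inverse q"
  note AKB = lin_simps[OF lin(1)] lin_simps[OF lin(2)] lin_simps[OF lin(3)]
  have "e *s Q (A v) - ((e * r * r) *s A (Q v) +
      s *s (\<alpha> *s Q (K v) + \<beta> *s Q (B v) + \<gamma> *s K (Q v) + \<delta> *s B (Q v))) =
    (e * h * a * s * a * (1 + r) - s * (\<alpha> * h * a + \<gamma> * h * a)) *s K (K (K v)) +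
    (- e * u * r * s * a - s * (\<beta> * h * a - \<gamma> * u)) *s K (K (B v)) +
    (s * (\<alpha> * u + \<gamma> * w)) *s K (B (K v)) +
    (- e * u * s * a' - s * (\<gamma> * h * a' - \<beta> * u)) *s K (B (B v)) +
    (- e * w * s * a - s * (\<delta> * h * a - \<alpha> * w)) *s B (K (K v)) +
    (s * (\<beta> * w + \<delta> * u)) *s B (K (B v)) +
    (- e * w * r * s * a' - s * (\<alpha> * h * a' - \<delta> * w)) *s B (B (K v)) +
    (e * h * a' * s * a' * (1 + r) - s * (\<beta> * h * a' + \<delta> * h * a')) *s B (B (B v)) +
    (e * (h * a * s * a' * (1 + r) - u * s * a - w * r * s * a)) *s K v +
    (e * (h * a' * s * a * (1 + r) - u * r * s * a' - w * s * a')) *s B v"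
    unfolding Q_def KA BA AKB a'_def[symmetric]
    by (simp add: scale_right_distrib scale_left_distrib scale_right_diff_distrib
        scale_left_diff_distrib algebra_simps)
  also have "\<dots> = 0"
  proof -
    \<comment> \<open>Eight equations for the cubic monomials, then two for the multiples of
      \<open>K v\<close> and \<open>B v\<close> that come from the last terms of \<open>KA\<close>
      and \<open>BA\<close>.\<close>
    have "e * h * a * s * a * (1 + r) - s * (\<alpha> * h * a + \<gamma> * h * a) = 0"
      "- e * u * r * s * a - s * (\<beta> * h * a - \<gamma> * u) = 0"
      "s * (\<alpha> * u + \<gamma> * w) = 0"
      "- e * u * s * a' - s * (\<gamma> * h * a' - \<beta> * u) = 0"
      "- e * w * s * a - s * (\<delta> * h * a - \<alpha> * w) = 0"
      "s * (\<beta> * w + \<delta> * u) = 0"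
      "- e * w * r * s * a' - s * (\<alpha> * h * a' - \<delta> * w) = 0"
      "e * h * a' * s * a' * (1 + r) - s * (\<beta> * h * a' + \<delta> * h * a') = 0"
      "e * (h * a * s * a' * (1 + r) - u * s * a - w * r * s * a) = 0"
      "e * (h * a' * s * a * (1 + r) - u * r * s * a' - w * s * a') = 0"
      using nz(1,2) unfolding \<alpha>_def \<beta>_def \<gamma>_def \<delta>_def e_def a'_def h_def u_def w_def r_def s_def
      by (simp_all add: field_simps power2_eq_square)
    then show ?thesis by (simp only: scale_zero_left add_0_left)
  qed
  finally have "e *s Q (A v) = 0"
    using Q by (simp add: lin_zero[OF lin(1)] lin_zero[OF lin(2)] lin_zero[OF lin(3)])
  then show ?thesis using nz(3) by (simp add: e_def)
qed

end

section \<open>The \<open>q\<close>-exponential function\<close>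

lemma q_fact_0: "q_fact q 0 = 1"
  by (simp add: q_fact_def)

lemma q_fact_Suc: "q_fact q (Suc n) = q_fact q n * q_int q (Suc n)"
  by (simp add: q_fact_def prod.nat_ivl_Suc' mult.commute)

lemma choose_Suc_2: "Suc n choose 2 = n + (n choose 2)"
  by (simp add: numeral_2_eq_2)

lemma q_int_times:
  fixes q :: "'a::field"
  assumes "q \<noteq> 0" "q ^ 2 \<noteq> 1"
  shows "q_int q n * (q - inverse q) * q ^ n = q ^ (2 * n) - 1"
proof -
  have "q - inverse q \<noteq> 0"
    using assms by (auto simp: field_simps power2_eq_square)
  then have "q_int q n * (q - inverse q) = q ^ n - inverse q ^ n"
    by (simp add: q_int_def)
  moreover have "inverse q ^ n * q ^ n = 1"
    using assms(1) by (simp add: power_mult_distrib[symmetric])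
  ultimately show ?thesis
    by (simp add: left_diff_distrib power_add[symmetric] mult_2)
qed

context endomorphisms
begin

lemma lin_funpow_eq_zero:
  assumes "lin T" "T ^^ m = (\<lambda>_. 0)" "m \<le> n"
  shows "T ^^ n = (\<lambda>_. 0)"
proof -
  have "T ^^ n = T ^^ (n - m) \<circ> T ^^ m" using assms(3) by (simp add: funpow_add[symmetric])
  then show ?thesis using assms(2) lin_zero[OF lin_funpow[OF assms(1)]] by (simp add: o_def)
qed

lemma exp_q_eq:
  assumes "lin T" "T ^^ Suc d = (\<lambda>_. 0)"
  shows "exp_q scale q T v = (\<Sum>n\<le>d. (q ^ (n choose 2) / q_fact q n) *s (T ^^ n) v)"
    and "exp_q_inv scale q T v = (\<Sum>n\<le>d. (inverse q ^ (n choose 2) / q_fact q n) *s (T ^^ n) v)"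
proof -
  have "{n. T ^^ n \<noteq> (\<lambda>_. 0)} \<subseteq> {..d}"
    using lin_funpow_eq_zero[OF assms] by (auto simp: not_less_eq_eq[symmetric])
  then show "exp_q scale q T v = (\<Sum>n\<le>d. (q ^ (n choose 2) / q_fact q n) *s (T ^^ n) v)"
    and "exp_q_inv scale q T v = (\<Sum>n\<le>d. (inverse q ^ (n choose 2) / q_fact q n) *s (T ^^ n) v)"
    unfolding exp_q_def exp_q_inv_def by (auto intro!: sum.mono_neutral_left)
qed

lemma q_commute_funpow:
  assumes "lin T" "\<And>v. K (T v) = c *s T (K v)"
  shows "K ((T ^^ n) v) = c ^ n *s (T ^^ n) (K v)"
proof (induct n)
  case (Suc n)
  then show ?case
    by (simp add: assms(2) lin_scale[OF assms(1)] mult.commute)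
qed simp

lemma q_commute_sum:
  assumes "lin T" "lin K" "\<And>v. K (T v) = c *s T (K v)"
  shows "K (\<Sum>n\<le>d. e n *s (T ^^ n) v) = (\<Sum>n\<le>d. (e n * c ^ n) *s (T ^^ n) (K v))"
  by (simp add: lin_sum[OF assms(2)] lin_scale[OF assms(2)] q_commute_funpow[where T = T and K = K and c = c, OF assms(1,3)])

lemma funpow_sum_shift:
  assumes "lin T" "T ^^ Suc d = (\<lambda>_. 0)"
  shows "T (\<Sum>n\<le>d. e n *s (T ^^ n) w) = (\<Sum>n<d. e n *s (T ^^ Suc n) w)"
proof -
  have "T (\<Sum>n\<le>d. e n *s (T ^^ n) w) = (\<Sum>n\<le>d. e n *s (T ^^ Suc n) w)"
    by (simp add: lin_sum[OF assms(1)] lin_scale[OF assms(1)])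
  also have "\<dots> = (\<Sum>n<d. e n *s (T ^^ Suc n) w)"
    unfolding lessThan_Suc_atMost[symmetric] sum.lessThan_Suc assms(2) by simp
  finally show ?thesis .
qed

text \<open>Moving \<open>K\<close> to the right replaces \<open>T\<close> by
  \<open>q\<^sup>2 T\<close> in the series. The claims are thus the functional equations
  \<open>exp\<^sub>q(T) = (1 - q h T) exp\<^sub>q(q\<^sup>2 T)\<close> and, for the other series,
  \<open>f(q\<^sup>2 T) = (1 + q h T) f(T)\<close>, with \<open>h = q - inverse q\<close>.\<close>

lemma exp_q_functional:
  assumes T: "lin T" "T ^^ Suc d = (\<lambda>_. 0)" and K: "lin K" "\<And>v. K (T v) = q\<^sup>2 *s T (K v)"
    and q: "q \<noteq> 0" "q\<^sup>2 \<noteq> 1" "\<And>n. 1 \<le> n \<Longrightarrow> n \<le> d \<Longrightarrow> q ^ (2 * n) \<noteq> 1"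
  shows "K (exp_q scale q T v) - (q * (q - inverse q)) *s T (K (exp_q scale q T v)) =
      exp_q scale q T (K v)"
    and "K (exp_q_inv scale q T v) =
      exp_q_inv scale q T (K v) + (q * (q - inverse q)) *s T (exp_q_inv scale q T (K v))"
proof -
  define h where "h = q - inverse q"
  define e f where "e n = q ^ (n choose 2) / q_fact q n"
    and "f n = inverse q ^ (n choose 2) / q_fact q n" for n
  have qi: "q_int q n * h * q ^ n = q ^ (2 * n) - 1" for n
    unfolding h_def by (rule q_int_times[OF q(1,2)])
  have nz: "q_int q n \<noteq> 0" if "1 \<le> n" "n \<le> d" for n
    using qi[of n] q(3)[OF that] by auto
  have fnz: "q_fact q n \<noteq> 0" if "n \<le> d" for n
    using that by (induct n) (auto simp: q_fact_0 q_fact_Suc nz)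
  \<comment> \<open>The coefficient of \<open>T ^^ Suc n\<close> in the functional equation; it
    reduces to \<open>qi\<close>.\<close>
  have e_Suc: "e (Suc n) * (q\<^sup>2) ^ Suc n = e (Suc n) + q * h * (e n * (q\<^sup>2) ^ n)" if "n < d" for n
  proof -
    have "e (Suc n) * (q ^ (2 * Suc n) - 1) = q * h * (e n * q ^ (2 * n))"
      unfolding qi[symmetric] e_def q_fact_Suc choose_Suc_2
      using nz[of "Suc n"] fnz[of n] that by (simp add: field_simps power_add mult_2_right)
    then show ?thesis
      unfolding power_mult[symmetric] by (simp only: right_diff_distrib mult_1_right diff_eq_eq add.commute)
  qed
  have f_Suc: "f (Suc n) * (q\<^sup>2) ^ Suc n = f (Suc n) + q * h * f n" if "n < d" for n
  proof -
    have "f (Suc n) * (q ^ (2 * Suc n) - 1) = q * h * f n"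
      unfolding qi[symmetric] f_def q_fact_Suc choose_Suc_2
      using nz[of "Suc n"] fnz[of n] that q(1) by (simp add: field_simps power_add)
    then show ?thesis
      unfolding power_mult[symmetric] by (simp only: right_diff_distrib mult_1_right diff_eq_eq add.commute)
  qed
  note eqs = exp_q_eq[OF T, of q, folded e_def f_def]
  \<comment> \<open>Since \<open>T ^^ Suc d\<close> is zero, the recurrence is only called for at
    \<open>n < d\<close>.\<close>
  have 1: "(\<Sum>n\<le>d. (e n * (q\<^sup>2) ^ n) *s (T ^^ n) (K v)) =
      (\<Sum>n\<le>d. e n *s (T ^^ n) (K v)) +
      (q * h) *s T (\<Sum>n\<le>d. (e n * (q\<^sup>2) ^ n) *s (T ^^ n) (K v))"
    unfolding funpow_sum_shift[OF T] unfolding sum.atMost_shift scale_sum_right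
    by (simp add: e_Suc scale_left_distrib sum.distrib del: power_Suc funpow.simps)
  have 2: "(\<Sum>n\<le>d. (f n * (q\<^sup>2) ^ n) *s (T ^^ n) (K v)) =
      (\<Sum>n\<le>d. f n *s (T ^^ n) (K v)) +
      (q * h) *s T (\<Sum>n\<le>d. f n *s (T ^^ n) (K v))"
    unfolding funpow_sum_shift[OF T] unfolding sum.atMost_shift scale_sum_right
    by (simp add: f_Suc scale_left_distrib sum.distrib del: power_Suc funpow.simps)
  show "K (exp_q scale q T v) - (q * (q - inverse q)) *s T (K (exp_q scale q T v)) =
      exp_q scale q T (K v)"
    unfolding eqs q_commute_sum[where T = T and K = K and c = "q\<^sup>2", OF T(1) K] h_def[symmetric] using 1 by (simp add: algebra_simps)
  show "K (exp_q_inv scale q T v) =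
      exp_q_inv scale q T (K v) + (q * (q - inverse q)) *s T (exp_q_inv scale q T (K v))"
    unfolding eqs q_commute_sum[where T = T and K = K and c = "q\<^sup>2", OF T(1) K] h_def[symmetric] by (rule 2)
qed

end

section \<open>TD systems of \<open>q\<close>-Racah type\<close>

locale q_racah = td_flags scale Basis d A As E Es \<theta> \<theta>s
  for scale :: "'a::field \<Rightarrow> 'b::ab_group_add \<Rightarrow> 'b" (infixr \<open>*s\<close> 75)
    and Basis d A As E Es \<theta> \<theta>s +
  fixes q a :: 'a
  assumes q_nz: "q \<noteq> 0" and a_nz: "a \<noteq> 0" and q4: "q ^ 4 \<noteq> 1" and d_pos: "d \<ge> 1"
    and inj_\<theta>: "inj_on \<theta> {..d}"
    and \<theta>_eq: "i \<le> d \<Longrightarrow> \<theta> i = a * q powi (int d - 2 * int i) + inverse a * q powi (2 * int i - int d)"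
begin

definition c :: "nat \<Rightarrow> 'a" where
  "c i = q powi (int d - 2 * int i)"

definition K :: "'b \<Rightarrow> 'b" where
  "K = diag_U c"

lemma c_nz: "c i \<noteq> 0"
  using q_nz by (simp add: c_def)

lemma c_add: "c i = q ^ (2 * n) * c (i + n)"
  using q_nz by (simp add: c_def power_int_add[symmetric] flip: power_int_of_nat)

lemma c_rev: "i \<le> d \<Longrightarrow> c (d - i) = inverse (c i)"
  by (simp add: c_def power_int_minus[symmetric] of_nat_diff)

lemma \<theta>_c: "i \<le> d \<Longrightarrow> \<theta> i = a * c i + inverse a * inverse (c i)"
  by (simp add: \<theta>_eq c_def power_int_minus[symmetric])

text \<open>Otherwise \<open>c 0 = c n\<close>, and the eigenvalues \<open>\<theta> 0\<close> and
  \<open>\<theta> n\<close> would coincide.\<close>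

lemma q_power_ne_1:
  assumes "1 \<le> n" "n \<le> d"
  shows "q ^ (2 * n) \<noteq> 1"
proof
  assume "q ^ (2 * n) = 1"
  then have "\<theta> 0 = \<theta> n" using c_add[of 0 n] assms by (simp add: \<theta>_c)
  then show False using inj_onD[OF inj_\<theta>, of 0 n] assms by simp
qed

lemma q2: "q\<^sup>2 \<noteq> 1"
  using q4 by (auto simp: power4_eq_xxxx power2_eq_square)

lemma q_diff: "q - inverse q \<noteq> 0"
  using q2 q_nz by (auto simp: field_simps power2_eq_square)

text \<open>\<open>c d\<close> is the inverse of \<open>c 0\<close>, so \<open>a = inverse a\<close>
  would make \<open>\<theta> 0\<close> and \<open>\<theta> d\<close> coincide.\<close>

lemma a_ne_inverse: "inverse a \<noteq> a"
proof
  assume "inverse a = a"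
  then have "\<theta> 0 = \<theta> d" using c_rev[of 0] by (simp add: \<theta>_c add.commute)
  then show False using inj_onD[OF inj_\<theta>, of 0 d] d_pos by simp
qed

lemma inj_c: "inj_on c {..d}"
proof (rule linorder_inj_onI)
  fix i j assume "i < j" "i \<in> {..d}" "j \<in> {..d}"
  then show "c i \<noteq> c j"
    using c_add[of i "j - i"] c_nz[of j] q_power_ne_1[of "j - i"] by simp
qed auto

lemma lin_K: "lin K"
  unfolding K_def by (rule lin_diag_U)

lemma K_U: "i \<le> d \<Longrightarrow> u \<in> U i \<Longrightarrow> K u = c i *s u"
  unfolding K_def by (rule diag_U_on_U)

lemma K_inverse: "diag_U (\<lambda>i. inverse (c i)) (K v) = v" "K (diag_U (\<lambda>i. inverse (c i)) v) = v"
  by (rule lin_eq_on_U[where g = "\<lambda>v. v", OF lin_compose[OF lin_diag_U lin_K] lin_ident];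
      simp add: K_U diag_U_on_U lin_scale[OF lin_diag_U] c_nz)
    (rule lin_eq_on_U[where g = "\<lambda>v. v", OF lin_compose[OF lin_K lin_diag_U] lin_ident];
      simp add: K_U diag_U_on_U lin_scale[OF lin_K] c_nz)

lemma inv_K: "inv K = diag_U (\<lambda>i. inverse (c i))"
  by (rule inv_unique_comp) (auto simp: K_inverse)

text \<open>The relation \<open>q K A - q\<^sup>-\<^sup>1 A K = (q - q\<^sup>-\<^sup>1) (a K\<^sup>2
  + a\<^sup>-\<^sup>1 I)\<close> divided by \<open>q\<close>. It holds on \<open>U i\<close> because
  \<open>A - \<theta> i\<close> raises to \<open>U (Suc i)\<close>, where \<open>K\<close> has
  eigenvalue \<open>q\<^sup>-\<^sup>2 c i\<close>.\<close>

lemma K_A: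
  "K (A v) = (inverse q ^ 2) *s A (K v) + ((1 - inverse q ^ 2) * a) *s K (K v)
    + ((1 - inverse q ^ 2) * inverse a) *s v"
proof (rule lin_eq_on_U[where f = "\<lambda>v. K (A v)" and v = v and g = "\<lambda>v. (inverse q ^ 2) *s A (K v)
    + ((1 - inverse q ^ 2) * a) *s K (K v) + ((1 - inverse q ^ 2) * inverse a) *s v"])
  fix i u assume i: "i \<le> d" and u: "u \<in> U i"
  define t where "t = A u - \<theta> i *s u"
  have Au: "A u = \<theta> i *s u + t" by (simp add: t_def)
  have t: "t \<in> U (Suc i)" unfolding t_def by (rule A_minus_U[OF u])
  have c_Suc: "c (Suc i) = inverse q ^ 2 * c i"
    using c_add[of i 1] q_nz by (simp add: field_simps power2_eq_square)
  \<comment> \<open>For \<open>i = d\<close> there is no next summand, and \<open>t\<close> is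
    zero.\<close>
  have "K t = c (Suc i) *s t"
  proof (cases "i = d")
    case True
    then have "t = 0" using t by (simp add: U_def H_top)
    then show ?thesis by (simp add: lin_zero[OF lin_K])
  qed (use i t K_U in simp)
  then have Kt: "K t = (inverse q ^ 2 * c i) *s t" by (simp add: c_Suc)
  \<comment> \<open>Comparison of the coefficients of \<open>u\<close>; those of \<open>t\<close>
    agree by \<open>Kt\<close>.\<close>
  have "\<theta> i * c i = inverse q ^ 2 * (c i * \<theta> i) + (1 - inverse q ^ 2) * a * (c i * c i)
      + (1 - inverse q ^ 2) * inverse a"
    using c_nz[of i] by (simp add: \<theta>_c[OF i] algebra_simps)
  then show "K (A u) = (inverse q ^ 2) *s A (K u) + ((1 - inverse q ^ 2) * a) *s K (K u)
    + ((1 - inverse q ^ 2) * inverse a) *s u"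
    by (simp add: Au K_U[OF i u] lin_simps[OF lin_K] lin_scale[OF R.lin_T] Kt
        scale_right_distrib mult.assoc flip: scale_left_distrib)
qed (intro lin_intros lin_compose[OF lin_K] lin_compose[OF R.lin_T] lin_K R.lin_T)+

text \<open>Reversal inverts \<open>a\<close> and keeps \<open>q\<close>, so \<open>K_A\<close> also
  yields the relation between \<open>A\<close> and the map \<open>B\<close>.\<close>

lemma reversed_q:
  "q_racah scale Basis d A As (\<lambda>i. E (d - i)) Es (\<lambda>i. \<theta> (d - i)) \<theta>s q (inverse a)"
proof (intro q_racah.intro reversed q_racah_axioms.intro)
  show "inj_on (\<lambda>i. \<theta> (d - i)) {..d}"
  proof (rule inj_onI)
    fix i j assume "i \<in> {..d}" "j \<in> {..d}" "\<theta> (d - i) = \<theta> (d - j)"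
    then show "i = j" using inj_onD[OF inj_\<theta>, of "d - i" "d - j"] by auto
  qed
  show "\<theta> (d - i) = inverse a * q powi (int d - 2 * int i)
      + inverse (inverse a) * q powi (2 * int i - int d)" if "i \<le> d" for i
    using that by (simp add: \<theta>_eq of_nat_diff algebra_simps)
qed (use q_nz a_nz q4 d_pos in auto)

end

section \<open>The quadratic relation between \<open>K\<close> and \<open>B\<close>\<close>

context q_racah
begin

interpretation D: q_racah scale Basis d A As "\<lambda>i. E (d - i)" Es "\<lambda>i. \<theta> (d - i)" \<theta>s q "inverse a"
  by (rule reversed_q)

text \<open>In this context, the map \<open>B\<close> of the paper is \<open>D.K\<close>.\<close>

lemma K_minus_DK_L:
  assumes "n \<le> d" "v \<in> L (Suc n)"
  shows "K v - D.K v \<in> L n"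
  using subspace_diff[OF subspace_L diag_U_minus_L[OF assms, of c] D.diag_U_minus_L[OF assms, of c]]
  by (simp add: K_def D.K_def)

definition Q :: "'b \<Rightarrow> 'b" where
  "Q v = ((q - inverse q) * a) *s K (K v) - (inverse a * q - a * inverse q) *s K (D.K v)
    - (a * q - inverse a * inverse q) *s D.K (K v) + ((q - inverse q) * inverse a) *s D.K (D.K v)"

lemma lin_Q: "lin Q"
  unfolding Q_def
  by (intro lin_minus lin_plus lin_scale_right lin_compose[OF lin_K lin_K]
      lin_compose[OF lin_K D.lin_K] lin_compose[OF D.lin_K lin_K] lin_compose[OF D.lin_K D.lin_K])

text \<open>The largest \<open>K\<close>- and \<open>B\<close>-stable subspace \<open>Z\<close> of
  the kernel of \<open>Q\<close> is shown to be \<open>A\<close>-stable. Stability is demanded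
  because \<open>quadratic_relation_step\<close> asks for \<open>Q\<close> to vanish at
  \<open>K v\<close> and \<open>B v\<close> too.\<close>

lemma Q_zero: "Q v = 0"
proof -
  define good where "good S \<longleftrightarrow> (\<forall>x\<in>S. K x \<in> S \<and> D.K x \<in> S \<and> Q x = 0)" for S
  have good_span: "good (span X)"
    if "\<And>x. x \<in> X \<Longrightarrow> K x \<in> span X \<and> D.K x \<in> span X \<and> Q x = 0" for X
  proof -
    have "K ` span X \<subseteq> span X"
      by (rule lin_image_span_subset[OF lin_K subspace_span]) (use that in blast)
    moreover have "D.K ` span X \<subseteq> span X"
      by (rule lin_image_span_subset[OF D.lin_K subspace_span]) (use that in blast)
    moreover have "Q ` span X \<subseteq> {0}"
      by (rule lin_image_span_subset[OF lin_Q subspace_single_0]) (use that in blast)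
    ultimately show ?thesis by (auto simp: good_def image_subset_iff)
  qed
  \<comment> \<open>The span of all good sets is again good, hence the largest one.\<close>
  define Z where "Z = span (\<Union>{S. good S})"
  have ZI: "v \<in> Z" if "good S" "v \<in> S" for v S
    unfolding Z_def using that by (intro span_base) auto
  have "good Z"
    unfolding Z_def
  proof (rule good_span)
    fix x assume "x \<in> \<Union>{S. good S}"
    then obtain S where S: "good S" "x \<in> S" by auto
    then have "K x \<in> \<Union>{S. good S}" "D.K x \<in> \<Union>{S. good S}" "Q x = 0"
      by (auto simp: good_def)
    then show "K x \<in> span (\<Union>{S. good S}) \<and> D.K x \<in> span (\<Union>{S. good S}) \<and> Q x = 0"
      by (intro conjI span_base)
  qed
  then have Z: "K x \<in> Z" "D.K x \<in> Z" "Q x = 0" if "x \<in> Z" for x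
    using that by (auto simp: good_def)
  \<comment> \<open>Adjoining \<open>A z\<close> keeps \<open>Z\<close> good by the commutation
    relations of \<open>A\<close> with \<open>K\<close> and \<open>B\<close>; maximality then puts
    \<open>A z\<close> into \<open>Z\<close>.\<close>
  let ?X = "Z \<union> A ` Z"
  have "good (span ?X)"
  proof (rule good_span)
    have base: "y \<in> span ?X" "A y \<in> span ?X" if "y \<in> Z" for y
      using that by (auto intro!: span_base)
    fix x assume "x \<in> ?X"
    then show "K x \<in> span ?X \<and> D.K x \<in> span ?X \<and> Q x = 0"
    proof
      assume "x \<in> A ` Z"
      then obtain z where z: "z \<in> Z" and x: "x = A z" by auto
      have "K x \<in> span ?X"
        unfolding x K_A using z by (intro span_add span_scale base Z)
      moreover have "D.K x \<in> span ?X"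
        unfolding x D.K_A using z by (intro span_add span_scale base Z)
      moreover have "Q x = 0"
        unfolding x
        by (rule quadratic_relation_step[OF R.lin_T lin_K D.lin_K q_nz a_nz a_ne_inverse K_A
              D.K_A[unfolded inverse_inverse_eq] Q_def Z(3)[OF z] Z(3)[OF Z(1)[OF z]] Z(3)[OF Z(2)[OF z]]])
      ultimately show ?thesis by blast
    qed (use Z base in blast)
  qed
  then have "A z \<in> Z" if "z \<in> Z" for z
    by (rule ZI) (use that in \<open>blast intro: span_base\<close>)
  moreover have "v \<in> Z" if i: "2 * i \<le> d" and v: "v \<in> U i" "v \<in> D.U i" for i v
  proof -
    have Kv: "K v = c i *s v" "D.K v = c i *s v" using i v by (auto simp: K_U D.K_U)
    \<comment> \<open>\<open>K\<close> and \<open>B\<close> are the same scalar here, and the four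
      coefficients of \<open>Q\<close> sum to zero.\<close>
    have "(q - inverse q) * a * (c i * c i) - (inverse a * q - a * inverse q) * (c i * c i)
      - (a * q - inverse a * inverse q) * (c i * c i) + (q - inverse q) * inverse a * (c i * c i) = 0"
      by (simp add: algebra_simps)
    then have "Q v = 0"
      by (simp add: Q_def Kv lin_scale[OF lin_K] lin_scale[OF D.lin_K] mult.assoc
          flip: scale_left_distrib scale_left_diff_distrib)
    then have "good (span {v})"
      by (intro good_span) (simp add: Kv span_scale span_base)
    then show ?thesis by (rule ZI) (simp add: span_base)
  qed
  moreover have "subspace Z" unfolding Z_def by (rule subspace_span)
  ultimately have "v \<in> Z"
    using generated_UNIV[OF inj_\<theta>, of Z v] by blast
  then show ?thesis by (rule Z(3))
qed

section \<open>The map \<open>\<psi>\<close>: nilpotency and commutation with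
  \<open>K\<close>\<close>

definition X :: "'b \<Rightarrow> 'b" where
  "X v = D.K (inv K v)"

definition Y :: "'b \<Rightarrow> 'b" where
  "Y v = q *s (a *s v - inverse a *s X v)"

definition \<psi> :: "'b \<Rightarrow> 'b" where
  "\<psi> v = inv Y v - X (inv Y v)"

lemma X_K: "X (K v) = D.K v"
  by (simp add: X_def inv_K K_inverse)

lemma lin_X: "lin X"
  unfolding X_def inv_K by (rule lin_compose[OF D.lin_K lin_diag_U])

lemma lin_Y: "lin Y"
  unfolding Y_def by (intro lin_scale_right lin_minus lin_ident lin_X)

text \<open>\<open>I - X\<close> is \<open>K - B\<close> after the inverse of \<open>K\<close>, and
  that inverse preserves the flag.\<close>

lemma X_minus_L:
  assumes "n \<le> d" "v \<in> L (Suc n)"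
  shows "v - X v \<in> L n"
  using K_minus_DK_L[OF assms(1) diag_U_L[OF assms(2), of "\<lambda>i. inverse (c i)"]]
  by (simp add: X_def inv_K K_inverse)

text \<open>As \<open>N\<close> lowers the flag, writing \<open>v\<close> as
  \<open>(v - N v) + N v\<close> pushes \<open>v\<close> down from \<open>L (Suc d)\<close> one
  level at a time until level \<open>n\<close>.\<close>

lemma lowering_cancel:
  assumes N: "\<And>n v. n \<le> d \<Longrightarrow> v \<in> L (Suc n) \<Longrightarrow> N v \<in> L n"
    and v: "v - N v \<in> L n"
  shows "v \<in> L n"
proof (cases "n \<le> Suc d")
  case True
  then show ?thesis
  proof (induct rule: inc_induct)
    case base
    then show ?case by (simp add: L_top)
  next
    case (step m)
    then have "N v \<in> L m" "v - N v \<in> L m"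
      using N[of m v] v L_mono[of n m] by auto
    then show ?case using subspace_diff_memD[OF subspace_L] by blast
  qed
qed (simp add: L_top)

lemma lowering_inj:
  assumes "\<And>n v. n \<le> d \<Longrightarrow> v \<in> L (Suc n) \<Longrightarrow> N v \<in> L n" and "v - N v = 0"
  shows "v = 0"
  using lowering_cancel[of N v 0] assms by (auto simp: L_0)

text \<open>\<open>Y\<close> is the nonzero scalar \<open>q * (a - inverse a)\<close> times the
  identity plus a multiple of the flag-lowering map \<open>I - X\<close>. The case
  \<open>n = 0\<close> gives injectivity of \<open>Y\<close>.\<close>

lemma Y_L:
  assumes "Y v \<in> L n"
  shows "v \<in> L n"
proof (rule lowering_cancel)
  let ?t = "inverse a / (a - inverse a)" and ?s = "q * (a - inverse a)"
  have s: "?s \<noteq> 0" using q_nz a_ne_inverse by simp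
  have "Y v = ?s *s v + (q * inverse a) *s (v - X v)"
    by (simp add: Y_def scale_right_diff_distrib scale_left_diff_distrib right_diff_distrib)
  also have "q * inverse a = ?s * ?t" using a_ne_inverse by simp
  finally have "Y v = ?s *s (v - (- ?t) *s (v - X v))"
    by (simp only: scale_minus_left diff_minus_eq_add scale_right_distrib scale_scale)
  then have "inverse ?s *s Y v = v - (- ?t) *s (v - X v)"
    using s by (simp only: scale_scale left_inverse[OF s] scale_one)
  then show "v - (- ?t) *s (v - X v) \<in> L n"
    using subspace_scale[OF subspace_L assms, of "inverse ?s"] by simp
  show "(- ?t) *s (w - X w) \<in> L m" if "m \<le> d" "w \<in> L (Suc m)" for m w
    by (rule subspace_scale[OF subspace_L X_minus_L[OF that]])
qed

lemma Y_zero: "Y v = 0 \<Longrightarrow> v = 0"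
  using Y_L[of v 0] by (simp add: L_0)

lemma bij_Y: "bij Y"
proof -
  have "inj Y"
    using Y_zero by (simp add: module_hom.inj_iff_eq_0[OF lin_hom[OF lin_Y]])
  then show ?thesis
    using linear_inj_imp_surj[OF lin_Y] by (simp add: bij_def)
qed

lemma Y_inv [simp]: "Y (inv Y v) = v" and inv_Y [simp]: "inv Y (Y v) = v"
  using bij_Y by (auto simp: bij_def surj_f_inv_f)

lemma psi_Y: "\<psi> (Y v) = v - X v"
  by (simp add: \<psi>_def)

lemma Y_X: "Y (X v) = X (Y v)"
  by (simp add: Y_def lin_simps[OF lin_X])

lemma Y_psi: "Y (\<psi> v) = v - X v"
  by (simp add: \<psi>_def lin_diff[OF lin_Y] Y_X)

lemma lin_psi: "lin \<psi>"
proof (rule linI)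
  show "\<psi> (v + w) = \<psi> v + \<psi> w" for v w
    using psi_Y[of "inv Y v + inv Y w"] by (simp add: lin_add[OF lin_Y] lin_add[OF lin_X] \<psi>_def)
  show "\<psi> (t *s v) = t *s \<psi> v" for t v
    using psi_Y[of "t *s inv Y v"]
    by (simp add: lin_scale[OF lin_Y] lin_scale[OF lin_X] \<psi>_def scale_right_diff_distrib)
qed

lemma psi_L: "n \<le> d \<Longrightarrow> v \<in> L (Suc n) \<Longrightarrow> \<psi> v \<in> L n"
  using X_minus_L[OF _ Y_L[of "inv Y v"]] by (simp add: \<psi>_def)

lemma psi_funpow_L: "n + k \<le> Suc d \<Longrightarrow> v \<in> L (n + k) \<Longrightarrow> (\<psi> ^^ k) v \<in> L n"
proof (induct k arbitrary: n)
  case (Suc k)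
  then have "(\<psi> ^^ k) v \<in> L (Suc n)" by simp
  then show ?case using Suc(2) psi_L[of n] by simp
qed simp

lemma psi_nilpotent: "\<psi> ^^ Suc d = (\<lambda>_. 0)"
  using psi_funpow_L[of 0 "Suc d"] by (auto simp: L_0 L_top simp del: funpow.simps)

text \<open>This identity is equivalent to \<open>Q = 0\<close>.\<close>

lemma K_psi: "K (\<psi> v) = q\<^sup>2 *s \<psi> (K v)"
proof -
  define w where "w = inv Y v"
  \<comment> \<open>With \<open>v = Y (K x)\<close> both inverses disappear: after applying
    \<open>Y\<close>, the two sides are quadratic in \<open>K\<close> and \<open>B\<close>,
    evaluated at \<open>x\<close>.\<close>
  define x where "x = inv K w"
  have w: "w = K x" by (simp add: x_def inv_K K_inverse)
  have v: "v = Y w" by (simp add: w_def)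
  have Yw: "Y w = q *s (a *s K x - inverse a *s D.K x)"
    by (simp add: Y_def w X_K)
  have "Y (K (\<psi> v)) = Y (K (K x) - K (D.K x))"
    by (simp add: v psi_Y w X_K lin_diff[OF lin_K])
  also have "\<dots> = (q * a) *s K (K x) - (q * a) *s K (D.K x)
      - (q * inverse a) *s D.K (K x) + (q * inverse a) *s D.K (D.K x)"
    by (simp add: Y_def lin_diff[OF lin_X] X_K scale_right_diff_distrib)
  \<comment> \<open>The two sides differ by exactly \<open>q\<^sup>2 *s Q x\<close>.\<close>
  also have "\<dots> = q\<^sup>2 *s (K (Y w) - X (K (Y w))) - q\<^sup>2 *s Q x"
    using q_nz unfolding Yw X_K Q_def
    by (simp add: lin_simps[OF lin_K] lin_simps[OF D.lin_K] scale_right_diff_distrib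
        scale_right_distrib scale_left_diff_distrib power2_eq_square algebra_simps)
  also have "\<dots> = Y (q\<^sup>2 *s \<psi> (K v))"
    by (simp add: Q_zero lin_scale[OF lin_Y] Y_psi v)
  finally show ?thesis
    using bij_Y by (simp add: bij_def inj_eq)
qed

text \<open>The linear factor of the functional equation: for \<open>T = (t / h) \<psi>\<close> with
  \<open>h = q - inverse q\<close>, the map \<open>1 - q h T\<close> is \<open>G t\<close>.\<close>

definition G :: "'a \<Rightarrow> 'b \<Rightarrow> 'b" where
  "G t v = v - (q * t) *s \<psi> v"

lemma lin_G: "lin (G t)"
  unfolding G_def by (intro lin_minus lin_ident lin_scale_right lin_psi)

lemma G_eqD:
  assumes "G t v = G t w"
  shows "v = w"
proof -
  have "(v - w) - (q * t) *s \<psi> (v - w) = 0"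
    using assms lin_diff[OF lin_G, of t v w] by (simp add: G_def)
  then have "v - w = 0"
    by (rule lowering_inj[rotated]) (intro subspace_scale subspace_L psi_L)
  then show ?thesis by simp
qed

text \<open>Composed with \<open>Y\<close>, the map \<open>G a\<close> becomes
  \<open>q (a - a\<^sup>-\<^sup>1) X\<close> and \<open>G (inverse a)\<close> becomes
  \<open>q (a - a\<^sup>-\<^sup>1) I\<close>. Hence \<open>G a = G (inverse a) X\<close>, and
  \<open>X K = B\<close>.\<close>

lemma G_K: "G a (K v) = G (inverse a) (D.K v)"
proof -
  have "Y (G a z) = (q * (a - inverse a)) *s X z" for z
    by (simp add: G_def lin_diff[OF lin_Y] lin_scale[OF lin_Y] Y_psi)
      (simp add: Y_def scale_right_diff_distrib scale_left_diff_distrib right_diff_distrib)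
  moreover have "Y (G (inverse a) (X z)) = (q * (a - inverse a)) *s X z" for z
    by (simp add: G_def lin_diff[OF lin_Y] lin_scale[OF lin_Y] Y_psi)
      (simp add: Y_def scale_right_diff_distrib scale_left_diff_distrib right_diff_distrib)
  ultimately have "Y (G a (K v)) = Y (G (inverse a) (X (K v)))" by simp
  then show ?thesis using bij_Y by (simp add: bij_def inj_eq X_K)
qed

section \<open>Exponentials of \<open>\<psi>\<close> and the intertwining of \<open>K\<close> and
  \<open>B\<close>\<close>

definition Exp :: "'a \<Rightarrow> 'b \<Rightarrow> 'b" where
  "Exp t = exp_q scale q (\<lambda>v. (t / (q - inverse q)) *s \<psi> v)"

text \<open>The sign is built in so that \<open>Exp_inv t\<close> becomes the inverse of
  \<open>Exp t\<close>.\<close>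

definition Exp_inv :: "'a \<Rightarrow> 'b \<Rightarrow> 'b" where
  "Exp_inv t = exp_q_inv scale q (\<lambda>v. (- (t / (q - inverse q))) *s \<psi> v)"

lemma scaled_psi:
  "lin (\<lambda>v. s *s \<psi> v)" "(\<lambda>v. s *s \<psi> v) ^^ n = (\<lambda>v. s ^ n *s (\<psi> ^^ n) v)"
  "(\<lambda>v. s *s \<psi> v) ^^ Suc d = (\<lambda>_. 0)" "K (s *s \<psi> v) = q\<^sup>2 *s s *s \<psi> (K v)"
proof -
  show "lin (\<lambda>v. s *s \<psi> v)" by (intro lin_scale_right lin_psi)
  show eq: "(\<lambda>v. s *s \<psi> v) ^^ n = (\<lambda>v. s ^ n *s (\<psi> ^^ n) v)" for n
    by (induct n) (auto simp: lin_scale[OF lin_psi] mult.commute)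
  show "(\<lambda>v. s *s \<psi> v) ^^ Suc d = (\<lambda>_. 0)"
    unfolding eq psi_nilpotent by simp
  show "K (s *s \<psi> v) = q\<^sup>2 *s s *s \<psi> (K v)"
    by (simp add: lin_scale[OF lin_K] K_psi mult.commute)
qed

text \<open>The common form of both exponentials; it supplies commutation, and unipotency when the
  constant coefficient is one.\<close>

definition poly_psi :: "(nat \<Rightarrow> 'a) \<Rightarrow> 'b \<Rightarrow> 'b" where
  "poly_psi e v = (\<Sum>n\<le>d. e n *s (\<psi> ^^ n) v)"

lemma lin_poly_psi: "lin (poly_psi e)"
  unfolding poly_psi_def by (intro lin_setsum lin_scale_right lin_funpow lin_psi)

lemma poly_psi_commute:
  assumes "lin f" "\<And>v. f (\<psi> v) = \<psi> (f v)"
  shows "f (poly_psi e v) = poly_psi e (f v)"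
proof -
  have "f ((\<psi> ^^ n) v) = (\<psi> ^^ n) (f v)" for n
    by (induct n) (simp_all add: assms(2))
  then show ?thesis
    by (simp add: poly_psi_def lin_sum[OF assms(1)] lin_scale[OF assms(1)])
qed

lemma psi_poly_psi: "\<psi> (poly_psi e v) = poly_psi e (\<psi> v)"
  by (rule poly_psi_commute[OF lin_psi refl])

lemma poly_psi_poly_psi: "poly_psi e (poly_psi f v) = poly_psi f (poly_psi e v)"
  by (rule poly_psi_commute[OF lin_poly_psi psi_poly_psi[symmetric]])

lemma G_poly_psi: "G t (poly_psi e v) = poly_psi e (G t v)"
  by (rule poly_psi_commute[OF lin_G]) (simp add: G_def lin_diff[OF lin_psi] lin_scale[OF lin_psi])

lemma poly_psi_unipotent:
  assumes "e 0 = 1" "n \<le> d" "v \<in> L (Suc n)"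
  shows "poly_psi e v - v \<in> L n"
proof -
  \<comment> \<open>The constant term cancels, and every other term contains a factor
    \<open>\<psi>\<close>, which lowers the flag.\<close>
  have "poly_psi e v - v = (\<Sum>k<d. e (Suc k) *s (\<psi> ^^ k) (\<psi> v))"
    unfolding poly_psi_def sum.atMost_shift by (simp add: assms(1) funpow_swap1)
  moreover have "(\<psi> ^^ k) (\<psi> v) \<in> L n" for k
  proof (induct k)
    case 0
    then show ?case using assms psi_L by simp
  next
    case (Suc k)
    then have "(\<psi> ^^ k) (\<psi> v) \<in> L (Suc n)" using L_mono[of n "Suc n"] by auto
    then show ?case using assms(2) psi_L by simp
  qed
  ultimately show ?thesis
    by (simp add: subspace_sum subspace_scale subspace_L)
qed

lemma Exp_poly_psi:
  obtains e where "e 0 = 1" "Exp t = poly_psi e"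
proof
  show "Exp t = poly_psi (\<lambda>n. q ^ (n choose 2) / q_fact q n * (t / (q - inverse q)) ^ n)"
    by (rule ext)
      (simp only: Exp_def poly_psi_def exp_q_eq[OF scaled_psi(1,3)] scaled_psi(2) scale_scale)
qed (simp add: q_fact_0 numeral_2_eq_2)

lemma Exp_inv_poly_psi:
  obtains e where "e 0 = 1" "Exp_inv t = poly_psi e"
proof
  show "Exp_inv t = poly_psi (\<lambda>n. inverse q ^ (n choose 2) / q_fact q n * (- (t / (q - inverse q))) ^ n)"
    by (rule ext)
      (simp only: Exp_inv_def poly_psi_def exp_q_eq[OF scaled_psi(1,3)] scaled_psi(2) scale_scale)
qed (simp add: q_fact_0 numeral_2_eq_2)

text \<open>Together with \<open>K_Exp_inv\<close>: moving \<open>K\<close> to the right absorbs a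
  factor \<open>G t\<close> at \<open>Exp t\<close> and creates one at
  \<open>Exp_inv t\<close>.\<close>

lemma G_K_Exp: "G t (K (Exp t v)) = Exp t (K v)"
proof -
  let ?h = "q - inverse q"
  have "K (Exp t v) - (q * ?h) *s ((t / ?h) *s \<psi> (K (Exp t v))) = Exp t (K v)"
    unfolding Exp_def
    by (rule exp_q_functional(1)[where T = "\<lambda>v. (t / ?h) *s \<psi> v" and q = q and d = d])
      (use scaled_psi lin_K q_nz q2 q_power_ne_1 in blast)+
  moreover have "q * ?h * (t / ?h) = q * t" using q_diff by simp
  ultimately show ?thesis unfolding G_def by (simp only: scale_scale)
qed

lemma K_Exp_inv: "K (Exp_inv t v) = G t (Exp_inv t (K v))"
proof -
  let ?h = "q - inverse q"
  have "K (Exp_inv t v) = Exp_inv t (K v) + (q * ?h) *s (- (t / ?h) *s \<psi> (Exp_inv t (K v)))"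
    unfolding Exp_inv_def
    by (rule exp_q_functional(2)[where T = "\<lambda>v. (- (t / ?h)) *s \<psi> v" and q = q and d = d])
      (use scaled_psi lin_K q_nz q2 q_power_ne_1 in blast)+
  moreover have "q * ?h * (t / ?h) = q * t" using q_diff by simp
  ultimately show ?thesis unfolding G_def by (simp only: scale_scale scale_minus_left scale_minus_right add_uminus_conv_diff)
qed

lemma Exp_Exp_inv_unipotent:
  assumes "n \<le> d" "v \<in> L (Suc n)"
  shows "Exp s (Exp_inv t v) - v \<in> L n"
proof -
  obtain e where e: "e 0 = 1" "Exp s = poly_psi e" by (rule Exp_poly_psi)
  obtain f where f: "f 0 = 1" "Exp_inv t = poly_psi f" by (rule Exp_inv_poly_psi)
  have 1: "Exp_inv t v - v \<in> L n" unfolding f(2) by (rule poly_psi_unipotent[of f, OF f(1) assms])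
  then have "Exp_inv t v - v \<in> L (Suc n)" using L_mono[of n "Suc n"] by auto
  then have "Exp_inv t v \<in> L (Suc n)" using assms(2) by (rule subspace_diff_memD[OF subspace_L])
  then have "Exp s (Exp_inv t v) - Exp_inv t v \<in> L n"
    unfolding e(2) by (rule poly_psi_unipotent[of e, OF e(1) assms(1)])
  from subspace_add[OF subspace_L this 1] show ?thesis by simp
qed

lemma lin_Exp: "lin (Exp t)" and lin_Exp_inv: "lin (Exp_inv t)"
  by (metis Exp_poly_psi lin_poly_psi) (metis Exp_inv_poly_psi lin_poly_psi)

lemma G_Exp: "G s (Exp t v) = Exp t (G s v)"
  by (metis Exp_poly_psi G_poly_psi)

text \<open>
  The product commutes with \<open>K\<close>, so it preserves each \<open>U i\<close>; being unipotent with respect to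
  the flag \<open>L\<close>, it is the identity.
\<close>

lemma Exp_Exp_inv: "Exp t (Exp_inv t v) = v"
proof (rule lin_eq_on_U[where g = "\<lambda>v. v", OF lin_compose[OF lin_Exp lin_Exp_inv] lin_ident])
  fix i u assume i: "i \<le> d" and u: "u \<in> U i"
  have "G t (K (Exp t (Exp_inv t u))) = G t (Exp t (Exp_inv t (K u)))"
    by (simp add: G_K_Exp K_Exp_inv G_Exp)
  then have "K (Exp t (Exp_inv t u)) = c i *s Exp t (Exp_inv t u)"
    by (simp add: G_eqD K_U[OF i u] lin_scale[OF lin_Exp] lin_scale[OF lin_Exp_inv])
  then have "Exp t (Exp_inv t u) \<in> U i"
    using diag_U_eigenvector[OF inj_c i] by (simp add: K_def)
  then have "Exp t (Exp_inv t u) - u \<in> H i"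
    using u by (auto simp: U_def intro: subspace_diff[OF subspace_H])
  moreover have "Exp t (Exp_inv t u) - u \<in> L i"
    using u by (intro Exp_Exp_inv_unipotent i) (auto simp: U_def)
  ultimately have "Exp t (Exp_inv t u) - u = 0" using L_Int_H by blast
  then show "Exp t (Exp_inv t u) = u" by simp
qed

lemma Exp_inv_Exp: "Exp_inv t (Exp t v) = v"
  by (metis Exp_Exp_inv Exp_inv_poly_psi Exp_poly_psi poly_psi_poly_psi)

text \<open>The middle factors cancel first, then the outer ones; exchanging \<open>s\<close> and
  \<open>t\<close> gives the other composition.\<close>

lemma Exp_products_inverse:
  "Exp s (Exp_inv t (Exp t (Exp_inv s v))) = v"
  by (simp add: Exp_inv_Exp Exp_Exp_inv)

text \<open>By \<open>G_K\<close>, \<open>G (inverse a) B = G a K\<close>. Moving \<open>K\<close>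
  to the right absorbs \<open>G a\<close> at \<open>Exp a\<close> and creates
  \<open>G (inverse a)\<close> at \<open>Exp_inv (inverse a)\<close>; this factor commutes to the
  front and cancels.\<close>

lemma intertwine: "D.K (Exp a (Exp_inv (inverse a) v)) = Exp a (Exp_inv (inverse a) (K v))"
proof (rule G_eqD)
  show "G (inverse a) (D.K (Exp a (Exp_inv (inverse a) v))) =
      G (inverse a) (Exp a (Exp_inv (inverse a) (K v)))"
    by (simp add: G_K[symmetric] G_K_Exp K_Exp_inv G_Exp)
qed

lemma Exp_product_U:
  assumes "i \<le> d" "u \<in> U i"
  shows "Exp a (Exp_inv (inverse a) u) \<in> D.U i"
proof -
  have "D.K (Exp a (Exp_inv (inverse a) u)) = c i *s Exp a (Exp_inv (inverse a) u)"
    by (simp add: intertwine K_U[OF assms] lin_scale[OF lin_Exp] lin_scale[OF lin_Exp_inv])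
  then show ?thesis
    using D.diag_U_eigenvector[OF inj_c assms(1)] by (simp add: D.K_def)
qed

text \<open>The difference of two candidates maps \<open>U i\<close> into
  \<open>L i \<inter> D.H i\<close>, which is zero.\<close>

lemma transition_unique:
  assumes "lin f" "lin g"
    and "\<And>i u. i \<le> d \<Longrightarrow> u \<in> U i \<Longrightarrow> f u \<in> D.U i" "\<And>i u. i \<le> d \<Longrightarrow> u \<in> U i \<Longrightarrow> f u - u \<in> L i"
    and "\<And>i u. i \<le> d \<Longrightarrow> u \<in> U i \<Longrightarrow> g u \<in> D.U i" "\<And>i u. i \<le> d \<Longrightarrow> u \<in> U i \<Longrightarrow> g u - u \<in> L i"
  shows "f = g"
proof
  fix v show "f v = g v"
  proof (rule lin_eq_on_U[OF assms(1,2)])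
    fix i u assume u: "i \<le> d" "u \<in> U i"
    have "f u - g u \<in> L i"
      using subspace_diff[OF subspace_L assms(4)[OF u] assms(6)[OF u]] by simp
    moreover have "f u - g u \<in> D.H i"
      using subspace_diff[OF D.subspace_U assms(3)[OF u] assms(5)[OF u]] by (simp add: D.U_def)
    ultimately have "f u - g u = 0" using D.L_Int_H by blast
    then show "f u = g u" by simp
  qed
qed

section \<open>Identification of the split subspaces, \<open>\<psi>\<close> and
  \<open>\<Delta>\<close>\<close>

lemma split_U_eq:
  assumes "i \<le> d"
  shows "split_U d E Es i = U i"
proof -
  have J: "{0..i} \<subseteq> {..d}" "{i..d} \<subseteq> {..d}" using assms by auto
  show ?thesis
    unfolding split_U_def U_def L_def H_def S.sum_ranges[OF J(1)] R.sum_ranges[OF J(2)]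
    by (intro arg_cong2[where f = inter] Collect_cong) (auto simp: Suc_le_eq not_le)
qed

lemma split_Udown_eq:
  assumes "i \<le> d"
  shows "split_Udown d E Es i = D.U i"
proof -
  have J: "{0..i} \<subseteq> {..d}" "{0..d - i} \<subseteq> {..d}" using assms by auto
  have eq: "(\<forall>j\<le>d. j \<notin> {0..d - i} \<longrightarrow> E j v = 0) \<longleftrightarrow> (\<forall>j\<le>d. j < i \<longrightarrow> E (d - j) v = 0)" for v
  proof (intro iffI allI impI)
    fix j assume *: "\<forall>j\<le>d. j \<notin> {0..d - i} \<longrightarrow> E j v = 0" "j \<le> d" "j < i"
    then have "d - j \<le> d" "d - j \<notin> {0..d - i}" using assms by auto
    then show "E (d - j) v = 0" using *(1) by blast
  next
    fix j assume *: "\<forall>j\<le>d. j < i \<longrightarrow> E (d - j) v = 0" "j \<le> d" "j \<notin> {0..d - i}"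
    then have "d - j \<le> d" "d - j < i" "d - (d - j) = j" using assms by auto
    then show "E j v = 0" using *(1) by metis
  qed
  show ?thesis
    unfolding split_Udown_def D.U_def L_def D.H_def S.sum_ranges[OF J(1)] R.sum_ranges[OF J(2)] eq
    by (intro arg_cong2[where f = inter] Collect_cong) (auto simp: Suc_le_eq not_le)
qed

text \<open>Turns the defining condition of \<open>Delta\<close> into membership in
  \<open>L i\<close>. The components \<open>pr j v\<close> with \<open>j < i\<close> telescope to
  \<open>P i v\<close>, which is \<open>v\<close> on \<open>L i\<close>.\<close>

lemma sum_split_U:
  assumes "i \<le> d"
  shows "(\<Sum>j<i. split_U d E Es j) = L i"
proof -
  have "(\<Sum>j<i. split_U d E Es j) = (\<Sum>j<i. U j)"
    using assms by (intro sum.cong) (auto simp: split_U_eq)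
  also have "\<dots> = L i"
    unfolding set_sum_alt[OF finite_lessThan]
  proof safe
    fix s assume s: "\<forall>j\<in>{..<i}. s j \<in> U j"
    show "sum s {..<i} \<in> L i"
    proof (rule subspace_sum[OF subspace_L])
      fix j assume "j \<in> {..<i}"
      then show "s j \<in> L i" using s L_mono[of "Suc j" i] by (auto simp: U_def)
    qed
  next
    fix v assume v: "v \<in> L i"
    have "(\<Sum>j<i. pr j v) = P i v - P 0 v"
      unfolding pr_def by (rule sum_lessThan_telescope)
    then have "v = (\<Sum>j<i. pr j v)" using v by (simp add: P_on_L P_on_H H_0)
    then show "\<exists>s. v = sum s {..<i} \<and> (\<forall>j\<in>{..<i}. s j \<in> U j)"
      by (intro exI[of _ "\<lambda>j. pr j v"] conjI ballI pr_U)
  qed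
  finally show ?thesis .
qed

lemma K_map_eq: "K_map scale q d E Es = K"
  unfolding K_map_def
proof (rule the_equality)
  show "lin K \<and> (\<forall>i\<le>d. \<forall>u\<in>split_U d E Es i. K u = q powi (int d - 2 * int i) *s u)"
    using lin_K by (auto simp: split_U_eq K_U c_def)
  fix f assume f: "lin f \<and> (\<forall>i\<le>d. \<forall>u\<in>split_U d E Es i. f u = q powi (int d - 2 * int i) *s u)"
  show "f = K"
  proof (rule ext, rule lin_eq_on_U[of f K, OF _ lin_K])
  qed (use f in \<open>auto simp: split_U_eq K_U c_def\<close>)
qed

lemma B_map_eq: "B_map scale q d E Es = D.K"
  unfolding B_map_def
proof (rule the_equality)
  show "lin D.K \<and> (\<forall>i\<le>d. \<forall>u\<in>split_Udown d E Es i. D.K u = q powi (int d - 2 * int i) *s u)"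
    using D.lin_K by (auto simp: split_Udown_eq D.K_U c_def)
  fix f assume f: "lin f \<and> (\<forall>i\<le>d. \<forall>u\<in>split_Udown d E Es i. f u = q powi (int d - 2 * int i) *s u)"
  show "f = D.K"
  proof (rule ext, rule D.lin_eq_on_U[of f D.K, OF _ D.lin_K])
  qed (use f in \<open>auto simp: split_Udown_eq D.K_U c_def\<close>)
qed

lemma psi_eq: "psi scale q a d E Es = \<psi>"
  unfolding psi_def K_map_eq B_map_eq Let_def o_apply X_def[symmetric] Y_def[symmetric]
  by (simp add: fun_eq_iff \<psi>_def)

lemma Delta_eq: "Delta scale d E Es = Exp a \<circ> Exp_inv (inverse a)"
  unfolding Delta_def
proof (rule the_equality)
  have lin: "lin (Exp a \<circ> Exp_inv (inverse a))"
    unfolding o_def by (rule lin_compose[OF lin_Exp lin_Exp_inv])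
  have U: "(Exp a \<circ> Exp_inv (inverse a)) u \<in> D.U i"
    "(Exp a \<circ> Exp_inv (inverse a)) u - u \<in> L i" if "i \<le> d" "u \<in> U i" for i u
    using Exp_product_U[OF that] Exp_Exp_inv_unipotent[OF that(1), of u] that(2) by (auto simp: U_def)
  have "(Exp a \<circ> Exp_inv (inverse a)) ` split_U d E Es i \<subseteq> split_Udown d E Es i"
    "(\<lambda>u. (Exp a \<circ> Exp_inv (inverse a)) u - u) ` split_U d E Es i \<subseteq> (\<Sum>j<i. split_U d E Es j)"
    if "i \<le> d" for i
    unfolding sum_split_U[OF that] split_U_eq[OF that] split_Udown_eq[OF that]
    using U[OF that] by blast+
  with lin show "lin (Exp a \<circ> Exp_inv (inverse a)) \<and> (\<forall>i\<le>d.
      (Exp a \<circ> Exp_inv (inverse a)) ` split_U d E Es i \<subseteq> split_Udown d E Es i \<and>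
      (\<lambda>u. (Exp a \<circ> Exp_inv (inverse a)) u - u) ` split_U d E Es i \<subseteq> (\<Sum>j<i. split_U d E Es j))"
    by blast
  fix f
  assume f: "lin f \<and> (\<forall>i\<le>d. f ` split_U d E Es i \<subseteq> split_Udown d E Es i \<and>
      (\<lambda>u. f u - u) ` split_U d E Es i \<subseteq> (\<Sum>j<i. split_U d E Es j))"
  have f_U: "f u \<in> D.U i" "f u - u \<in> L i" if "i \<le> d" "u \<in> U i" for i u
  proof -
    have "f ` U i \<subseteq> D.U i" "(\<lambda>u. f u - u) ` U i \<subseteq> L i"
      using f that(1) unfolding sum_split_U[OF that(1), symmetric] split_U_eq[OF that(1), symmetric]
        split_Udown_eq[OF that(1), symmetric] by blast+
    then show "f u \<in> D.U i" "f u - u \<in> L i" using that(2) by auto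
  qed
  show "f = Exp a \<circ> Exp_inv (inverse a)"
    using f by (intro transition_unique[OF _ lin f_U U]) auto
qed

lemma inv_Exp_product: "inv (Exp a \<circ> Exp_inv (inverse a)) = Exp (inverse a) \<circ> Exp_inv a"
  by (rule inv_unique_comp) (simp_all add: fun_eq_iff Exp_products_inverse)

end

section \<open>TD systems of \<open>q\<close>-Racah type as instances of the locale, and the two
  formulas\<close>

lemma q_racah_TD_system:
  assumes fin: "finite_dimensional_vector_space scale Basis"
    and TD: "TD_system scale d A E As Es" and d: "d \<ge> 1"
    and q: "q_Racah_with scale q a b d A E As Es"
  shows "q_racah scale Basis d A As E Es (\<lambda>i. eigenvalue_on scale A (range (E i)))
    (\<lambda>i. eigenvalue_on scale As (range (Es i))) q a"
proof -
  interpret finite_dimensional_vector_space scale Basis by (rule fin)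
  interpret endomorphisms scale by unfold_locales
  have pair: "TD_pair scale A As"
    and E: "\<And>i. i \<le> d \<Longrightarrow> primitive_idempotent scale A (range (E i)) (E i)"
    and Es: "\<And>i. i \<le> d \<Longrightarrow> primitive_idempotent scale As (range (Es i)) (Es i)"
    and st: "standard_ordering scale A As d (\<lambda>i. range (E i))"
      "standard_ordering scale As A d (\<lambda>i. range (Es i))"
    using TD by (auto simp: TD_system_def)
  have lin: "lin A" "lin As" and diag: "diagonalizable scale A" "diagonalizable scale As"
    using pair by (auto simp: TD_pair_def)
  have bij: "bij_betw (\<lambda>i. range (E i)) {0..d} (eigenspaces scale A)"
    "bij_betw (\<lambda>i. range (Es i)) {0..d} (eigenspaces scale As)"
    using st by (auto simp: standard_ordering_def)
  note sE = spectral_primitive_idempotents[OF lin(1) diag(1) E bij(1)]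
  note sEs = spectral_primitive_idempotents[OF lin(2) diag(2) Es bij(2)]
  have irred: "W = {0} \<or> W = UNIV" if "subspace W" "A ` W \<subseteq> W" "As ` W \<subseteq> W" for W
    using pair that unfolding TD_pair_def by blast
  show ?thesis
  proof (intro q_racah.intro td_flags.intro td_flags_axioms.intro q_racah_axioms.intro
      fin endomorphisms_axioms sE(1) sEs(1))
    show "E j (As (E i v)) = 0" if "i \<le> d" "j \<le> d" "i + 1 < j \<or> j + 1 < i" for i j v
      by (rule spectral.tridiagonal_standard_ordering[OF sE(1) st(1) that])
    show "Es j (A (Es i v)) = 0" if "i \<le> d" "j \<le> d" "i + 1 < j \<or> j + 1 < i" for i j v
      by (rule spectral.tridiagonal_standard_ordering[OF sEs(1) st(2) that])
  qed (use sE sEs irred q d in \<open>auto simp: q_Racah_with_def\<close>)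
qed

theorem theorem7p2:
  fixes scale :: "'k::alg_closed_field \<Rightarrow> 'v::ab_group_add \<Rightarrow> 'v" (infixr \<open>*s\<close> 75)
    and Basis :: "'v set"
    and A As :: "'v \<Rightarrow> 'v" and E Es :: "nat \<Rightarrow> 'v \<Rightarrow> 'v"
    and d :: nat and q a b :: 'k and \<psi> \<Delta> :: "'v \<Rightarrow> 'v"
  assumes "finite_dimensional_vector_space scale Basis"
    and "vector_space.dim scale (UNIV :: 'v set) > 0"
    and "TD_system scale d A E As Es"
    and "d \<ge> 1"
    and "q_Racah_with scale q a b d A E As Es"
    and "\<psi> = psi scale q a d E Es"
    and "\<Delta> = Delta scale d E Es"
  shows "\<Delta> = exp_q scale q (\<lambda>v. (a / (q - inverse q)) *s \<psi> v) \<circ>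
               exp_q_inv scale q (\<lambda>v. (- (inverse a / (q - inverse q))) *s \<psi> v) \<and>
         inv \<Delta> = exp_q scale q (\<lambda>v. (inverse a / (q - inverse q)) *s \<psi> v) \<circ>
                  exp_q_inv scale q (\<lambda>v. (- (a / (q - inverse q))) *s \<psi> v)"
proof -
  interpret Q: q_racah scale Basis d A As E Es "\<lambda>i. eigenvalue_on scale A (range (E i))"
    "\<lambda>i. eigenvalue_on scale As (range (Es i))" q a
    by (rule q_racah_TD_system) (rule assms)+
  show ?thesis
    unfolding assms(6,7) Q.psi_eq Q.Delta_eq Q.inv_Exp_product
    by (simp only: Q.Exp_def Q.Exp_inv_def)
qed

end
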